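(* Let $M$ be a topological space and let $(M_\alpha)_{\alpha\in A}$ be a directed family of topological spaces whose union $M_\infty:=\bigcup_{\alpha\in A}M_\alpha$ is a dense subset of $M$. Assume that all inclusion maps $M_\alpha\to M$ and $M_\alpha\to M_\beta$ (for $\alpha\le\beta$) are continuous, and that $M$ admits well-filled charts. Let $\mathcal{O}$ be a topology on $M_\infty$ with the following properties: (a) all of the inclusion maps $\sigma_\alpha:M_\alpha\to(M_\infty,\mathcal{O})$ (for $\alpha\in A$) as well as $\sigma:(M_\infty,\mathcal{O})\to M$ are continuous; (b) $(M_\infty,\mathcal{O})=\bigcup_{\alpha\in A}M_\alpha$ is compactly retractive. Then $\sigma$ is a weak homotopy equivalence.
   Context: All topological spaces are Hausdorff. Topological vector spaces are real and need not be locally convex. A directed family $(X_\alpha)_{\alpha\in A}$ is a family of sets indexed by a directed set $(A,\le)$ with $X_\alpha\subseteq X_\beta$ whenever $\alpha\le\beta$. For a subset $Y$ of a vector space, $\mathrm{conv}_2(Y):=\{ty_1+(1-t)y_2: y_1,y_2\in Y,\ t\in[0,1]\}$. Compact retractivity: $(M_\infty,\mathcal{O})=\bigcup_{\alpha\in A}M_\alpha$ is compactly retractive if every compact subset $K$ of $(M_\infty,\mathcal{O})$ is contained in $M_\alpha$ for some $\alpha\in A$ such that $M_\alpha$ and $(M_\infty,\mathcal{O})$ induce the same topology on $K$. A continuous map $f:X\to Y$ is a weak homotopy equivalence if $f_*:\pi_k(X,p)\to\pi_k(Y,f(p))$ is a bijection for all $k\in\mathbb{N}_0=\{0,1,2,\dots\}$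 and $p\in X$. Well-filled charts. A well-filled chart of $M$ is a homeomorphism $\phi:U\to V\subseteq E$ from an open subset $U\subseteq M$ onto an arbitrary subset $V$ of a topological vector space $E$ such that there exist $\alpha_0\in A$ and, for all $\alpha\ge\alpha_0$, homeomorphisms $\phi_\alpha:U_\alpha\to V_\alpha\subseteq E_\alpha$ from open subsets $U_\alpha\subseteq M_\alpha$ onto subsets $V_\alpha$ of topological vector spaces $E_\alpha$, where the $E_\alpha$ are vector subspaces of $E$ with $E_\alpha\subseteq E_\beta$ for $\beta\ge\alpha$, each endowed with its own vector topology in such a way that the inclusion maps $E_\alpha\to E$ and $E_\alpha\to E_\beta$ are continuous, and the following holds: (a) for all $\alpha\ge\alpha_0$: $U_\alpha\subseteq U$ and $\phi|_{U_\alpha}=\phi_\alpha$ (as maps to $E$); (b) for all $\beta\ge\alpha\ge\alpha_0$: $U_\alpha\subseteq U_\beta$ and $\phi_\beta|_{U_\alpha}=\phi_\alpha$; (d) $\bigcup_{\alpha\ge\alpha_0}U_\alpha=U\cap M_\infty$; (e) there is a non-empty, relatively open subset $V^{(2)}\subseteq V$ such that $\mathrm{conv}_2(V^{(2)})\subseteq V$ and $\mathrm{conv}_2(V^{(2)}\cap V_\infty)\subseteq V_\infty$, where $V_\infty:=\bigcup_{\alpha\ge\alpha_0}V_\alpha$; (f) for each $\alpha\ge\alpha_0$ and each set $K\subseteq V^{(2)}_\alpha:=V^{(2)}\cap V_\alpha$ which is compact (in the topology of $E_\alpha$), there exists $\beta\ge\alpha$ such that $\mathrm{conv}_2(K)\subseteq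 V_\beta$. Then $U^{(2)}:=\phi^{-1}(V^{(2)})$ is called a core of $\phi$. The space $M$ is said to admit well-filled charts if $M$ is covered by cores of well-filled charts. *)

theory Defs
  imports "HOL-Analysis.Analysis"
begin

section \<open>Homotopy groups and weak homotopy equivalences\<close>

definition cube :: "nat \<Rightarrow> (nat \<Rightarrow> real) topology" where
  "cube k = product_topology (\<lambda>_. top_of_set {0..1}) {..<k}"

definition cube_boundary :: "nat \<Rightarrow> (nat \<Rightarrow> real) set" where
  "cube_boundary k = {x \<in> topspace (cube k). \<exists>i<k. x i = 0 \<or> x i = 1}"

definition cube_maps :: "nat \<Rightarrow> 'a topology \<Rightarrow> 'a \<Rightarrow> ((nat \<Rightarrow> real) \<Rightarrow> 'a) set" where
  "cube_maps k X p = {g. continuous_map (cube k) X g \<and> g ` cube_boundary k \<subseteq> {p}}"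

text \<open>Homotopy relative to the boundary. Functions that agree on the cube but differ elsewhere
  are related.\<close>

definition cube_homotopy ::
    "nat \<Rightarrow> 'a topology \<Rightarrow> 'a \<Rightarrow> (((nat \<Rightarrow> real) \<Rightarrow> 'a) \<times> ((nat \<Rightarrow> real) \<Rightarrow> 'a)) set" where
  "cube_homotopy k X p =
     {(g, h). homotopic_with (\<lambda>u. u ` cube_boundary k \<subseteq> {p}) (cube k) X g h}"

text \<open>The underlying set of the \<open>k\<close>-th homotopy group. The cube of dimension \<open>0\<close> is a single point
  with empty boundary, so for \<open>k = 0\<close> this is the set of path components.\<close>

definition homotopy_set :: "nat \<Rightarrow> 'a topology \<Rightarrow> 'a \<Rightarrow> ((nat \<Rightarrow> real) \<Rightarrow> 'a) set set" where
  "homotopy_set k X p = cube_maps k X p // cube_homotopy k X p"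

definition homotopy_induced ::
    "nat \<Rightarrow> 'b topology \<Rightarrow> 'b \<Rightarrow> ('a \<Rightarrow> 'b) \<Rightarrow> ((nat \<Rightarrow> real) \<Rightarrow> 'a) set \<Rightarrow> ((nat \<Rightarrow> real) \<Rightarrow> 'b) set" where
  "homotopy_induced k Y q f C = cube_homotopy k Y q `` ((\<lambda>g. f \<circ> g) ` C)"

definition weak_homotopy_equivalence :: "'a topology \<Rightarrow> 'b topology \<Rightarrow> ('a \<Rightarrow> 'b) \<Rightarrow> bool" where
  "weak_homotopy_equivalence X Y f \<longleftrightarrow>
     continuous_map X Y f \<and>
     (\<forall>k. \<forall>p\<in>topspace X.
        bij_betw (homotopy_induced k Y (f p) f) (homotopy_set k X p) (homotopy_set k Y (f p)))"

lemma equiv_cube_homotopy: "equiv (cube_maps k X p) (cube_homotopy k X p)"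
proof (rule equivI)
  show "cube_homotopy k X p \<subseteq> cube_maps k X p \<times> cube_maps k X p"
    unfolding cube_homotopy_def cube_maps_def
    by (auto dest: homotopic_with_imp_continuous_maps homotopic_with_imp_property)
  show "refl_on (cube_maps k X p) (cube_homotopy k X p)"
    unfolding refl_on_def cube_homotopy_def cube_maps_def by simp
  show "sym (cube_homotopy k X p)"
    by (auto simp: sym_def cube_homotopy_def intro: homotopic_with_symD)
  show "trans (cube_homotopy k X p)"
    by (rule transI) (simp add: cube_homotopy_def, rule homotopic_with_trans)
qed

lemma homotopy_induced_class:
  assumes f: "continuous_map X Y f" and g: "g \<in> cube_maps k X p"
  shows "homotopy_induced k Y (f p) f (cube_homotopy k X p `` {g}) =
         cube_homotopy k Y (f p) `` {f \<circ> g}"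
proof -
  have *: "(f \<circ> u, f \<circ> v) \<in> cube_homotopy k Y (f p)" if "(u, v) \<in> cube_homotopy k X p" for u v
    using that unfolding cube_homotopy_def
    by (simp, elim homotopic_with_compose_continuous_map_left[OF _ f]) auto
  have "cube_homotopy k Y (f p) `` {f \<circ> h} = cube_homotopy k Y (f p) `` {f \<circ> g}"
    if "(g, h) \<in> cube_homotopy k X p" for h
    using equiv_class_eq[OF equiv_cube_homotopy *[OF that]] by simp
  moreover have "(g, g) \<in> cube_homotopy k X p"
    using g unfolding cube_homotopy_def cube_maps_def by simp
  ultimately show ?thesis
    unfolding homotopy_induced_def by blast
qed

section \<open>Directed families and compact retractivity\<close>

definition directed_index :: "'i set \<Rightarrow> ('i \<Rightarrow> 'i \<Rightarrow> bool) \<Rightarrow> bool" where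
  "directed_index A le \<longleftrightarrow>
     A \<noteq> {} \<and> reflp_on A le \<and> transp_on A le \<and>
     (\<forall>\<alpha>\<in>A. \<forall>\<beta>\<in>A. \<exists>\<gamma>\<in>A. le \<alpha> \<gamma> \<and> le \<beta> \<gamma>)"

definition directed_family :: "'i set \<Rightarrow> ('i \<Rightarrow> 'i \<Rightarrow> bool) \<Rightarrow> ('i \<Rightarrow> 'a set) \<Rightarrow> bool" where
  "directed_family A le X \<longleftrightarrow>
     directed_index A le \<and> (\<forall>\<alpha>\<in>A. \<forall>\<beta>\<in>A. le \<alpha> \<beta> \<longrightarrow> X \<alpha> \<subseteq> X \<beta>)"

definition compactly_retractive :: "'a topology \<Rightarrow> 'i set \<Rightarrow> ('i \<Rightarrow> 'a topology) \<Rightarrow> bool" where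
  "compactly_retractive T A Ms \<longleftrightarrow>
     (\<forall>K. compactin T K \<longrightarrow>
        (\<exists>\<alpha>\<in>A. K \<subseteq> topspace (Ms \<alpha>) \<and> subtopology (Ms \<alpha>) K = subtopology T K))"

section \<open>Well-filled charts\<close>

text \<open>A Hausdorff real topological vector space, given as a vector subspace of an ambient real vector
  space (which itself carries no topology) together with a vector topology on it.\<close>

definition topological_vector_space :: "'e::real_vector topology \<Rightarrow> bool" where
  "topological_vector_space E \<longleftrightarrow>
     subspace (topspace E) \<and> Hausdorff_space E \<and>
     continuous_map (prod_topology E E) E (\<lambda>(x, y). x + y) \<and>
     continuous_map (prod_topology euclideanreal E) E (\<lambda>(t, x). t *\<^sub>R x)"

definition conv2 :: "'e::real_vector set \<Rightarrow> 'e set" where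
  "conv2 Y = {t *\<^sub>R y1 + (1 - t) *\<^sub>R y2 | t y1 y2. y1 \<in> Y \<and> y2 \<in> Y \<and> t \<in> {0..1}}"

text \<open>\<open>\<phi> : U \<rightarrow> V \<subseteq> E\<close> is a well-filled chart, as witnessed by \<open>\<alpha>0\<close>, the homeomorphisms
  \<open>\<phi>s \<alpha> : Us \<alpha> \<rightarrow> Vs \<alpha> \<subseteq> Es \<alpha>\<close> for \<open>\<alpha> \<ge> \<alpha>0\<close>, and the set \<open>V2\<close>.\<close>

definition well_filled_chart ::
    "'i set \<Rightarrow> ('i \<Rightarrow> 'i \<Rightarrow> bool) \<Rightarrow> 'a topology \<Rightarrow> ('i \<Rightarrow> 'a topology) \<Rightarrow>
     'e::real_vector topology \<Rightarrow> 'a set \<Rightarrow> 'e set \<Rightarrow> ('a \<Rightarrow> 'e) \<Rightarrow>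
     'i \<Rightarrow> ('i \<Rightarrow> 'e topology) \<Rightarrow> ('i \<Rightarrow> 'a set) \<Rightarrow> ('i \<Rightarrow> 'e set) \<Rightarrow> ('i \<Rightarrow> 'a \<Rightarrow> 'e) \<Rightarrow>
     'e set \<Rightarrow> bool" where
  "well_filled_chart A le M Ms E U V \<phi> \<alpha>0 Es Us Vs \<phi>s V2 \<longleftrightarrow>
     (let A0 = {\<alpha>\<in>A. le \<alpha>0 \<alpha>};
          Minf = (\<Union>\<alpha>\<in>A. topspace (Ms \<alpha>));
          Vinf = (\<Union>\<alpha>\<in>A0. Vs \<alpha>)
      in
        topological_vector_space E \<and> openin M U \<and> V \<subseteq> topspace E \<and>
        homeomorphic_map (subtopology M U) (subtopology E V) \<phi> \<and>
        \<alpha>0 \<in> A \<and>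
        (\<forall>\<alpha>\<in>A0.
           topological_vector_space (Es \<alpha>) \<and> continuous_map (Es \<alpha>) E id \<and>
           openin (Ms \<alpha>) (Us \<alpha>) \<and> Vs \<alpha> \<subseteq> topspace (Es \<alpha>) \<and>
           homeomorphic_map (subtopology (Ms \<alpha>) (Us \<alpha>)) (subtopology (Es \<alpha>) (Vs \<alpha>)) (\<phi>s \<alpha>)) \<and>
        (\<forall>\<alpha>\<in>A0. \<forall>\<beta>\<in>A0. le \<alpha> \<beta> \<longrightarrow> continuous_map (Es \<alpha>) (Es \<beta>) id) \<and>
        (\<forall>\<alpha>\<in>A0. Us \<alpha> \<subseteq> U \<and> (\<forall>x\<in>Us \<alpha>. \<phi> x = \<phi>s \<alpha> x)) \<and>
        (\<forall>\<alpha>\<in>A0. \<forall>\<beta>\<in>A0. le \<alpha> \<beta> \<longrightarrow> Us \<alpha> \<subseteq> Us \<beta> \<and> (\<forall>x\<in>Us \<alpha>. \<phi>s \<beta> x = \<phi>s \<alpha> x)) \<and>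
        (\<Union>\<alpha>\<in>A0. Us \<alpha>) = U \<inter> Minf \<and>
        V2 \<noteq> {} \<and> openin (subtopology E V) V2 \<and>
        conv2 V2 \<subseteq> V \<and> conv2 (V2 \<inter> Vinf) \<subseteq> Vinf \<and>
        (\<forall>\<alpha>\<in>A0. \<forall>K. K \<subseteq> V2 \<inter> Vs \<alpha> \<and> compactin (Es \<alpha>) K \<longrightarrow>
           (\<exists>\<beta>\<in>A0. le \<alpha> \<beta> \<and> conv2 K \<subseteq> Vs \<beta>)))"

text \<open>The modelling spaces of all charts of a cover are taken to be subspaces, each with its own
  topology, of one real vector space \<open>'e\<close>. This is no restriction: any set of topological vector
  spaces embeds linearly into its direct sum. The type argument makes \<open>'e\<close> visible.\<close>

definition core_of_well_filled_chart ::
    "'e::real_vector itself \<Rightarrow> 'i set \<Rightarrow> ('i \<Rightarrow> 'i \<Rightarrow> bool) \<Rightarrow> 'a topology \<Rightarrow> ('i \<Rightarrow> 'a topology) \<Rightarrow>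
     'a set \<Rightarrow> bool" where
  "core_of_well_filled_chart ty A le M Ms C \<longleftrightarrow>
     (\<exists>(E :: 'e topology) U V \<phi> \<alpha>0 Es Us Vs \<phi>s V2.
        well_filled_chart A le M Ms E U V \<phi> \<alpha>0 Es Us Vs \<phi>s V2 \<and> C = {x \<in> U. \<phi> x \<in> V2})"

definition admits_well_filled_charts ::
    "'e::real_vector itself \<Rightarrow> 'i set \<Rightarrow> ('i \<Rightarrow> 'i \<Rightarrow> bool) \<Rightarrow> 'a topology \<Rightarrow> ('i \<Rightarrow> 'a topology) \<Rightarrow>
     bool" where
  "admits_well_filled_charts ty A le M Ms \<longleftrightarrow>
     topspace M = \<Union>{C. core_of_well_filled_chart ty A le M Ms C}"

end

theory Submission
  imports Defs
begin

text \<open>In a well-filled chart, a small neighbourhood \<open>P\<close> of a point contains, by density, a point \<open>y\<close>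
  of \<open>M\<^sub>\<infinity>\<close>, and moving along straight segments towards \<open>y\<close> contracts \<open>P\<close> inside a prescribed
  neighbourhood. On compact subsets of \<open>(M\<^sub>\<infinity>, T)\<close> this contraction is also continuous for \<open>T\<close>,
  because by compact retractivity it takes place in a single step of the directed family.

  Let \<open>f\<close> be a map from a cube to \<open>M\<close> that is \<open>T\<close>-continuous near the boundary. Cover the cube by
  small closed boxes, in finitely many colours such that boxes of the same colour are disjoint.
  One colour after the other, push the map on each box along a contraction, with a bump function as
  time parameter. Where the bump function is \<open>1\<close> the map becomes constant, hence \<open>T\<close>-continuous;
  where the map is already \<open>T\<close>-continuous it remains so. The number of colours does not depend
  on the mesh, so the neighbourhoods of the graph of \<open>f\<close> in which the successive maps must stay
  can be chosen in advance, backwards. The result is a homotopy relative to the boundary from \<open>f\<close> to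
  a \<open>T\<close>-continuous map. For maps of \<open>k\<close>-cubes this gives surjectivity on \<open>\<pi>\<^sub>k\<close>; for homotopies,
  read as maps of \<open>(k + 1)\<close>-cubes, it gives injectivity.\<close>

abbreviation unit_interval :: "real topology" where
  "unit_interval \<equiv> top_of_set {0..1}"

text \<open>Pasting over two closed sets that need not cover \<open>X\<close>. It enlarges, piece by
  piece, the set on which a map is already \<open>T\<close>-continuous, and it assembles homotopies
  given by different formulas on closed pieces.\<close>

lemma continuous_map_subtopology_Un:
  assumes A: "closedin X A" and B: "closedin X B"
    and fA: "continuous_map (subtopology X A) Y f"
    and fB: "continuous_map (subtopology X B) Y f"
  shows "continuous_map (subtopology X (A \<union> B)) Y f"
proof -
  have sub: "A \<subseteq> topspace X" "B \<subseteq> topspace X"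
    using A B closedin_subset by blast+
  have "closedin (subtopology X (A \<union> B)) {x \<in> A \<union> B. f x \<in> D}" if D: "closedin Y D" for D
  proof -
    have "closedin (subtopology X A) {x \<in> A. f x \<in> D}" "closedin (subtopology X B) {x \<in> B. f x \<in> D}"
      using fA fB D sub by (auto simp: continuous_map_closedin Int_absorb1)
    then have "closedin X {x \<in> A. f x \<in> D}" "closedin X {x \<in> B. f x \<in> D}"
      using A B closedin_trans_full by blast+
    then have "closedin X ({x \<in> A. f x \<in> D} \<union> {x \<in> B. f x \<in> D})"
      by (rule closedin_Un)
    also have "{x \<in> A. f x \<in> D} \<union> {x \<in> B. f x \<in> D} = {x \<in> A \<union> B. f x \<in> D}"
      by auto
    finally show ?thesis
      by (auto intro: closedin_subset_topspace)
  qed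
  moreover have "\<forall>x \<in> A \<union> B. f x \<in> topspace Y"
    using fA fB sub by (auto simp: continuous_map_def Pi_iff)
  ultimately show ?thesis
    using sub by (simp add: continuous_map_closedin Int_absorb1)
qed

section \<open>Moving maps along local contractions\<close>

text \<open>The set \<open>P\<close> is contracted within \<open>W\<close> to a point of \<open>T\<close>, where \<open>T\<close> is thought of as a
  finer topology on a subset of \<open>M\<close>. For \<open>T\<close>, continuity is asked on compact sets only:
  this is what compact retractivity provides, and it suffices for maps from compact spaces.\<close>

definition local_contraction ::
    "'a topology \<Rightarrow> 'a topology \<Rightarrow> 'a set \<Rightarrow> 'a set \<Rightarrow> (real \<Rightarrow> 'a \<Rightarrow> 'a) \<Rightarrow> bool" where
  "local_contraction T M P W c \<longleftrightarrow>
     continuous_map (prod_topology unit_interval (subtopology M P)) (subtopology M W) (\<lambda>(t, p). c t p) \<and>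
     (\<forall>p\<in>P. c 0 p = p) \<and> (\<exists>y\<in>topspace T. \<forall>p\<in>P. c 1 p = y) \<and>
     (\<forall>K. compactin T K \<and> K \<subseteq> P \<longrightarrow>
        continuous_map (prod_topology unit_interval (subtopology T K)) T (\<lambda>(t, p). c t p))"

text \<open>The only property of well-filled charts on which the homotopy theory below rests. The
  point \<open>q\<close> ranges over all of \<open>M\<close>, whereas the contraction ends at a
  point of \<open>T\<close>.\<close>

definition locally_contracting :: "'a topology \<Rightarrow> 'a topology \<Rightarrow> bool" where
  "locally_contracting T M \<longleftrightarrow>
     (\<forall>q W. openin M W \<and> q \<in> W \<longrightarrow>
        (\<exists>P c. openin M P \<and> q \<in> P \<and> P \<subseteq> W \<and> local_contraction T M P W c))"

text \<open>The basic move: on \<open>C\<close> the map \<open>h\<close> is carried along the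
  contraction up to time \<open>l\<close>, elsewhere it rests. Since \<open>l\<close> vanishes off
  \<open>C\<close> and \<open>c 0\<close> is the identity on \<open>P\<close>, the two formulas fit
  together on the closed sets \<open>C\<close> and \<open>l = 0\<close>. Where \<open>l = 1\<close>
  on \<open>C\<close>, the new map is constant with value in \<open>T\<close>, so this set can be
  added to \<open>S\<close>.\<close>

lemma contract_on_closed:
  assumes X: "compact_space X" and lc: "local_contraction T M P W c"
    and h: "continuous_map X M h"
    and S: "closedin X S" and hT: "continuous_map (subtopology X S) T h"
    and C: "closedin X C" and CP: "h ` C \<subseteq> P"
    and l: "continuous_map X unit_interval l" and l0: "\<And>x. x \<in> topspace X - C \<Longrightarrow> l x = 0"
    and Z: "\<And>x. x \<in> Z \<Longrightarrow> x \<in> topspace X \<and> l x = 0 \<and> h x = v x"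
  obtains h' where "homotopic_with (\<lambda>u. \<forall>x\<in>Z. u x = v x) X M h h'"
    and "\<And>x. x \<in> topspace X - C \<Longrightarrow> h' x = h x" and "h' ` C \<subseteq> W"
    and "continuous_map (subtopology X (S \<union> {x\<in>C. l x = 1})) T h'"
proof -
  obtain y where y: "y \<in> topspace T" "\<And>p. p \<in> P \<Longrightarrow> c 1 p = y"
    using lc by (auto simp: local_contraction_def)
  have c0: "\<And>p. p \<in> P \<Longrightarrow> c 0 p = p"
    using lc by (auto simp: local_contraction_def)
  then have c0C: "c 0 (h x) = h x" if "x \<in> C" for x
    using CP that by auto
  have cM: "continuous_map (prod_topology unit_interval (subtopology M P)) (subtopology M W) (\<lambda>(t, p). c t p)"
    using lc by (auto simp: local_contraction_def)
  have Csub: "C \<subseteq> topspace X" "S \<subseteq> topspace X"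
    using C S closedin_subset by auto
  have l01: "l x \<in> {0..1}" if "x \<in> topspace X" for x
    using l that by (auto simp: continuous_map_in_subtopology Pi_iff)
  have lr: "continuous_map X euclideanreal l"
    using l by (auto simp: continuous_map_in_subtopology)
  define H where "H = (\<lambda>(t, x). if x \<in> C then c (t * l x) (h x) else h x)"
  define L where "L = {x \<in> topspace X. l x = 0}"
  have L: "closedin X L"
    unfolding L_def using closedin_continuous_map_preimage[OF lr, of "{0}"] by simp
  have Hpair: "continuous_map (subtopology (prod_topology unit_interval X) ({0..1} \<times> C))
      (prod_topology unit_interval (subtopology M P)) (\<lambda>z. (fst z * l (snd z), h (snd z)))"
  proof -
    have 1: "continuous_map (prod_topology unit_interval X) euclideanreal (\<lambda>z. fst z * l (snd z))"
      by (intro continuous_map_real_mult continuous_map_compose[OF continuous_map_snd lr, unfolded o_def])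
        (use continuous_map_fst[of unit_interval X] in \<open>simp add: continuous_map_in_subtopology\<close>)
    have 2: "continuous_map (prod_topology unit_interval X) M (\<lambda>z. h (snd z))"
      using continuous_map_compose[OF continuous_map_snd h] by (simp add: o_def)
    show ?thesis
      using l01 CP Csub
      by (auto simp: continuous_map_pairwise o_def continuous_map_in_subtopology mult_le_one
          intro!: continuous_map_from_subtopology[OF 1] continuous_map_from_subtopology[OF 2])
  qed
  have HC: "continuous_map (subtopology (prod_topology unit_interval X) ({0..1} \<times> C)) (subtopology M W) H"
    by (rule continuous_map_eq[OF continuous_map_compose[OF Hpair cM]]) (auto simp: H_def)
  have HL: "continuous_map (subtopology (prod_topology unit_interval X) ({0..1} \<times> L)) M H"
  proof -
    have "continuous_map (prod_topology unit_interval X) M (h \<circ> snd)"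
      using continuous_map_compose[OF continuous_map_snd h] .
    then show ?thesis
      by (rule continuous_map_eq[OF continuous_map_from_subtopology])
        (use c0C in \<open>auto simp: H_def L_def\<close>)
  qed
  have cl: "closedin (prod_topology unit_interval X) ({0..1} \<times> C)"
      "closedin (prod_topology unit_interval X) ({0..1} \<times> L)"
    using C L by (simp_all add: closedin_prod_Times_iff)
  have cover: "topspace (prod_topology unit_interval X) = {0..1} \<times> C \<union> {0..1} \<times> L"
    using Csub l0 by (auto simp: L_def)
  have contH: "continuous_map (prod_topology unit_interval X) M H"
    using continuous_map_subtopology_Un[OF cl _ HL, folded cover] HC
    by (simp only: continuous_map_in_subtopology subtopology_topspace)
  define h' where "h' = (\<lambda>x. H (1, x))"
  have h'C: "h' x = c (l x) (h x)" if "x \<in> C" for x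
    using that by (simp add: h'_def H_def)
  have h'L: "h' x = h x" if "x \<in> L" for x
    using that c0C by (auto simp: h'_def H_def L_def)
  show ?thesis
  proof
    have H0: "H (0, x) = h x" for x
      using c0C by (auto simp: H_def)
    \<comment> \<open>A point of \<open>Z\<close> may lie in \<open>C\<close>, but its time
      parameter \<open>t * l x\<close> is always 0, so it never moves.\<close>
    have HZ: "\<forall>x\<in>Z. H (t, x) = v x" for t
      using Z c0C by (simp add: H_def) (metis (full_types))
    show "homotopic_with (\<lambda>u. \<forall>x\<in>Z. u x = v x) X M h h'"
      unfolding homotopic_with_def
      by (rule exI[of _ H]) (use contH H0 HZ in \<open>auto simp: h'_def\<close>)
    show "h' x = h x" if "x \<in> topspace X - C" for x
      using that by (auto simp: h'_def H_def)
    show "h' ` C \<subseteq> W"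
      using HC Csub by (auto simp: h'_def continuous_map_in_subtopology Pi_iff)
    have 1: "continuous_map (subtopology X (S \<inter> C)) T h'"
    proof -
      \<comment> \<open>\<open>S \<inter> C\<close> is closed in the compact space \<open>X\<close>,
        so its image is compact in \<open>T\<close>. This is why continuity of \<open>c\<close> over
        compact sets of \<open>T\<close> suffices.\<close>
      define K where "K = h ` (S \<inter> C)"
      have hK: "continuous_map (subtopology X (S \<inter> C)) T h"
        using hT continuous_map_from_subtopology_mono by blast
      have "compact_space (subtopology X (S \<inter> C))"
        using X S C by (simp add: closedin_Int closedin_compact_space compact_space_subtopology)
      then have K: "compactin T K"
        using image_compactin[OF _ hK, of "S \<inter> C"] Csub
        by (auto simp: K_def compact_space_def Int_absorb1 le_infI2)
      have KP: "K \<subseteq> P"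
        using CP by (auto simp: K_def)
      have cT: "continuous_map (prod_topology unit_interval (subtopology T K)) T (\<lambda>(t, p). c t p)"
        using lc K KP by (auto simp: local_contraction_def)
      have "continuous_map (subtopology X (S \<inter> C)) (prod_topology unit_interval (subtopology T K)) (\<lambda>x. (l x, h x))"
        using continuous_map_from_subtopology[OF l] hK
        by (auto simp: continuous_map_pairwise o_def continuous_map_in_subtopology K_def)
      from continuous_map_eq[OF continuous_map_compose[OF this cT]] show ?thesis
        by (simp add: h'C)
    qed
    have 2: "continuous_map (subtopology X (S \<inter> L)) T h'"
      by (rule continuous_map_eq[OF continuous_map_from_subtopology_mono[OF hT]]) (auto simp: h'L)
    have 3: "continuous_map (subtopology X {x\<in>C. l x = 1}) T h'"
      by (rule continuous_map_eq[where f = "\<lambda>x. y"]) (use y CP in \<open>auto simp: h'C\<close>)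
    have C1: "closedin X {x\<in>C. l x = 1}"
    proof -
      have "closedin X (C \<inter> {x\<in>topspace X. l x \<in> {1}})"
        using closedin_continuous_map_preimage[OF lr, of "{1}"] C
        by (intro closedin_Int) auto
      also have "\<dots> = {x\<in>C. l x = 1}"
        using Csub by auto
      finally show ?thesis .
    qed
    have "S = (S \<inter> C) \<union> (S \<inter> L)"
      using Csub l0 by (auto simp: L_def)
    then have "continuous_map (subtopology X S) T h'"
      using continuous_map_subtopology_Un[OF _ _ 1 2] S C L closedin_Int by metis
    then show "continuous_map (subtopology X (S \<union> {x\<in>C. l x = 1})) T h'"
      using continuous_map_subtopology_Un[OF S C1 _ 3] by blast
  qed
qed

text \<open>Near each point of the graph a product \<open>N \<times> W\<close> fits into
  \<open>Q\<close>, and some neighbourhood \<open>P\<close> of \<open>f x\<close> contracts within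
  \<open>W\<close>. Finitely many such places suffice; from \<open>Q\<close> one removes the
  positions over \<open>K G\<close> that lie outside \<open>P G\<close>. Finitely many closed sets
  are removed and the graph of \<open>f\<close> avoids them, so \<open>Q'\<close> is still an open
  neighbourhood of the graph. Any map with graph in \<open>Q'\<close> takes values in
  \<open>P G\<close> over \<open>G\<close>, and contracting it there keeps its graph in
  \<open>Q\<close>.\<close>

lemma contraction_control:
  assumes X: "compact_space X" "regular_space X" and f: "continuous_map X M f"
    and lc: "locally_contracting T M"
    and Q: "openin (prod_topology X M) Q" and fQ: "\<And>x. x \<in> topspace X \<Longrightarrow> (x, f x) \<in> Q"
  obtains Q' \<U> where "openin (prod_topology X M) Q'" and "Q' \<subseteq> Q"
    and "\<And>x. x \<in> topspace X \<Longrightarrow> (x, f x) \<in> Q'"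
    and "\<And>U. U \<in> \<U> \<Longrightarrow> openin X U" and "topspace X \<subseteq> \<Union>\<U>"
    and "\<And>U. U \<in> \<U> \<Longrightarrow> \<exists>P W c. local_contraction T M P W c \<and>
           (\<forall>x\<in>U. \<forall>p. (x, p) \<in> Q' \<longrightarrow> p \<in> P) \<and> U \<times> W \<subseteq> Q"
proof -
  \<comment> \<open>Regularity yields the closed set \<open>K\<close> around the open set
    \<open>G\<close>: the sets \<open>G\<close> form the cover, while \<open>K\<close> makes the
    removed rectangle closed.\<close>
  define good where "good G K P \<longleftrightarrow> openin X G \<and> closedin X K \<and> G \<subseteq> K \<and> f ` K \<subseteq> P \<and> openin M P \<and>
      (\<exists>W c. local_contraction T M P W c \<and> K \<times> W \<subseteq> Q)" for G K P
  have "\<exists>G K P. x \<in> G \<and> good G K P" if x: "x \<in> topspace X" for x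
  proof -
    obtain N W where NW: "openin X N" "openin M W" "x \<in> N" "f x \<in> W" "N \<times> W \<subseteq> Q"
      using Q[unfolded openin_prod_topology_alt, rule_format, OF fQ[OF x]] by blast
    obtain P c where P: "openin M P" "f x \<in> P" "local_contraction T M P W c"
      using lc[unfolded locally_contracting_def, rule_format, OF conjI[OF NW(2,4)]] by blast
    have "openin X (N \<inter> {x \<in> topspace X. f x \<in> P})"
      using NW(1) openin_continuous_map_preimage[OF f P(1)] by (rule openin_Int)
    moreover have "x \<in> N \<inter> {x \<in> topspace X. f x \<in> P}"
      using x NW P by simp
    moreover have "neighbourhood_base_of (closedin X) X"
      using X(2) by (simp add: neighbourhood_base_of_closedin)
    ultimately obtain G K where GK: "openin X G" "closedin X K" "x \<in> G" "G \<subseteq> K"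
        "K \<subseteq> N \<inter> {x \<in> topspace X. f x \<in> P}"
      unfolding neighbourhood_base_of by (elim allE impE) auto
    have "f ` K \<subseteq> P" "K \<times> W \<subseteq> Q"
      using GK(5) NW(5) by blast+
    then have "good G K P"
      unfolding good_def using GK P by blast
    then show ?thesis
      using GK(3) by blast
  qed
  then have cov: "topspace X \<subseteq> \<Union>{G. \<exists>K P. good G K P}"
    by blast
  moreover have "compactin X (topspace X)"
    using X(1) by (simp add: compact_space_def)
  moreover have "openin X G" if "G \<in> {G. \<exists>K P. good G K P}" for G
    using that by (auto simp: good_def)
  ultimately obtain \<F> where \<F>: "finite \<F>" "\<F> \<subseteq> {G. \<exists>K P. good G K P}" "topspace X \<subseteq> \<Union>\<F>"
    using compactinD[of X "topspace X" "{G. \<exists>K P. good G K P}"] by blast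
  have "\<forall>G\<in>\<F>. \<exists>K P. good G K P"
    using \<F>(2) by blast
  then obtain K P where good: "\<And>G. G \<in> \<F> \<Longrightarrow> good G (K G) (P G)"
    by metis
  define Q' where "Q' = Q - (\<Union>G\<in>\<F>. K G \<times> (topspace M - P G))"
  have QM: "Q \<subseteq> topspace X \<times> topspace M"
    using openin_subset[OF Q] by simp
  show ?thesis
  proof
    show "openin (prod_topology X M) Q'"
      unfolding Q'_def
    proof (intro openin_diff Q closedin_Union)
      show "finite ((\<lambda>G. K G \<times> (topspace M - P G)) ` \<F>)"
        using \<F>(1) by simp
      fix B assume "B \<in> (\<lambda>G. K G \<times> (topspace M - P G)) ` \<F>"
      then obtain G where "G \<in> \<F>" and B: "B = K G \<times> (topspace M - P G)"
        by blast
      then have "closedin X (K G)" "openin M (P G)"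
        using good unfolding good_def by blast+
      then show "closedin (prod_topology X M) B"
        unfolding B by (simp add: closedin_prod_Times_iff closedin_diff)
    qed
    show "Q' \<subseteq> Q"
      by (auto simp: Q'_def)
    show "(x, f x) \<in> Q'" if "x \<in> topspace X" for x
    proof -
      have "f x \<in> P G" if "G \<in> \<F>" "x \<in> K G" for G
        using good[OF that(1)] that(2) unfolding good_def by blast
      then show ?thesis
        using fQ[OF that] by (auto simp: Q'_def)
    qed
    show "topspace X \<subseteq> \<Union>\<F>"
      by fact
    fix U assume U: "U \<in> \<F>"
    show "openin X U"
      using good[OF U] by (simp add: good_def)
    obtain W c where c: "local_contraction T M (P U) W c" "K U \<times> W \<subseteq> Q" and UK: "U \<subseteq> K U"
      using good[OF U] unfolding good_def by (elim conjE exE)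
    have "p \<in> P U" if "x \<in> U" "(x, p) \<in> Q'" for x p
    proof -
      have "p \<in> topspace M" "(x, p) \<notin> K U \<times> (topspace M - P U)"
        using that(2) U QM unfolding Q'_def by blast+
      then show ?thesis
        using that(1) UK by blast
    qed
    moreover have "U \<times> W \<subseteq> Q"
      using UK c(2) by blast
    ultimately show "\<exists>P W c. local_contraction T M P W c \<and>
           (\<forall>x\<in>U. \<forall>p. (x, p) \<in> Q' \<longrightarrow> p \<in> P) \<and> U \<times> W \<subseteq> Q"
      using c(1) by (intro exI[of _ "P U"] exI[of _ W] exI[of _ c]) simp
  qed
qed

section \<open>Bump families and induction over the colours\<close>

definition bump_family ::
    "'x topology \<Rightarrow> nat \<Rightarrow> 'j set \<Rightarrow> ('j \<Rightarrow> nat) \<Rightarrow> ('j \<Rightarrow> 'x set) \<Rightarrow> ('j \<Rightarrow> 'x \<Rightarrow> real) \<Rightarrow> bool" where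
  "bump_family X n J col C l \<longleftrightarrow>
     finite J \<and> (\<forall>a\<in>J. col a < n) \<and>
     (\<forall>a\<in>J. closedin X (C a) \<and> continuous_map X unit_interval (l a) \<and>
        (\<forall>x\<in>topspace X - C a. l a x = 0)) \<and>
     (\<forall>a\<in>J. \<forall>b\<in>J. a \<noteq> b \<and> col a = col b \<longrightarrow> C a \<inter> C b = {})"

lemma bump_family_closedin:
  assumes "bump_family X n J col C l" and "a \<in> J"
  shows "closedin X {x \<in> C a. l a x = 1}"
proof -
  have C: "closedin X (C a)" and "continuous_map X euclideanreal (l a)"
    using assms by (auto simp: bump_family_def continuous_map_in_subtopology)
  then have "closedin X (C a \<inter> {x\<in>topspace X. l a x \<in> {1}})"
    by (intro closedin_Int closedin_continuous_map_preimage[of X euclideanreal]) auto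
  also have "\<dots> = {x \<in> C a. l a x = 1}"
    using closedin_subset[OF C] by auto
  finally show ?thesis .
qed

text \<open>Induction on the finite set \<open>J\<close>, one contraction at a time. Disjointness is
  decisive: the moves made so far do not change \<open>h\<close> on \<open>C a\<close>, so
  \<open>contr\<close>, which speaks of the original \<open>h\<close>, still supplies a contraction
  for the current map. A whole colour therefore costs only one change of the admissible set, however
  many boxes it has.\<close>

lemma contract_on_disjoint:
  assumes X: "compact_space X"
    and bump: "bump_family X n J col C l"
    and disj: "\<And>a b. a \<in> J \<Longrightarrow> b \<in> J \<Longrightarrow> col a = col b"
    and h: "continuous_map X M h"
    and S: "closedin X S" and hT: "continuous_map (subtopology X S) T h"
    and hQ: "\<And>x. x \<in> topspace X \<Longrightarrow> (x, h x) \<in> Q"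
    and contr: "\<And>a. a \<in> J \<Longrightarrow> \<exists>P W c. local_contraction T M P W c \<and> h ` C a \<subseteq> P \<and> C a \<times> W \<subseteq> Q"
    and Z: "\<And>x. x \<in> Z \<Longrightarrow> x \<in> topspace X \<and> (\<forall>a\<in>J. l a x = 0) \<and> h x = v x"
  shows "\<exists>h'. homotopic_with (\<lambda>u. \<forall>x\<in>Z. u x = v x) X M h h' \<and>
           (\<forall>x\<in>topspace X - (\<Union>a\<in>J. C a). h' x = h x) \<and>
           (\<forall>x\<in>topspace X. (x, h' x) \<in> Q) \<and>
           continuous_map (subtopology X (S \<union> (\<Union>a\<in>J. {x\<in>C a. l a x = 1}))) T h'"
proof -
  have "finite J"
    using bump by (simp add: bump_family_def)
  then show ?thesis
    using bump disj contr Z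
  proof (induction J)
    case empty
    then show ?case
      using h hT hQ by (intro exI[of _ h]) auto
  next
    case (insert a J)
    have bJ: "bump_family X n J col C l"
      using insert.prems(1) by (auto simp: bump_family_def)
    have p2: "col b = col c" if "b \<in> J" "c \<in> J" for b c
      using that by (intro insert.prems(2)) simp_all
    have p3: "\<exists>P W c. local_contraction T M P W c \<and> h ` C b \<subseteq> P \<and> C b \<times> W \<subseteq> Q"
      if "b \<in> J" for b
      using that by (intro insert.prems(3)) simp
    have p4: "x \<in> topspace X \<and> (\<forall>a\<in>J. l a x = 0) \<and> h x = v x" if "x \<in> Z" for x
      using insert.prems(4)[OF that] by simp
    obtain h1 where h1: "homotopic_with (\<lambda>u. \<forall>x\<in>Z. u x = v x) X M h h1"
        "\<forall>x\<in>topspace X - (\<Union>a\<in>J. C a). h1 x = h x" "\<forall>x\<in>topspace X. (x, h1 x) \<in> Q"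
        "continuous_map (subtopology X (S \<union> (\<Union>a\<in>J. {x\<in>C a. l a x = 1}))) T h1"
      using insert.IH[OF bJ p2 p3 p4] by blast
    obtain P W c where PWc: "local_contraction T M P W c" "h ` C a \<subseteq> P" "C a \<times> W \<subseteq> Q"
      using insert.prems(3)[of a] by blast
    have Ca: "closedin X (C a)" "continuous_map X unit_interval (l a)"
        "\<And>x. x \<in> topspace X - C a \<Longrightarrow> l a x = 0"
      using insert.prems(1) by (auto simp: bump_family_def)
    have "C a \<inter> C b = {}" if "b \<in> J" for b
    proof -
      have "a \<noteq> b" "col a = col b"
        using that insert.hyps(2) insert.prems(2)[of a b] by auto
      then show ?thesis
        using insert.prems(1) that unfolding bump_family_def by simp
    qed
    then have "h1 x = h x" if "x \<in> C a" for x
      using h1(2) that closedin_subset[OF Ca(1)] by blast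
    then have h1P: "h1 ` C a \<subseteq> P"
      using PWc(2) by auto
    have S1: "closedin X (S \<union> (\<Union>a\<in>J. {x\<in>C a. l a x = 1}))"
      using insert.hyps(1) S bump_family_closedin[OF bJ]
      by (intro closedin_Un closedin_Union) blast+
    have Z1: "x \<in> topspace X \<and> l a x = 0 \<and> h1 x = v x" if "x \<in> Z" for x
      using insert.prems(4)[OF that] homotopic_with_imp_property[OF h1(1)] that by simp
    have h1M: "continuous_map X M h1"
      using homotopic_with_imp_continuous_maps[OF h1(1)] by blast
    obtain h' where h': "homotopic_with (\<lambda>u. \<forall>x\<in>Z. u x = v x) X M h1 h'"
        "\<And>x. x \<in> topspace X - C a \<Longrightarrow> h' x = h1 x" "h' ` C a \<subseteq> W"
        "continuous_map (subtopology X (S \<union> (\<Union>a\<in>J. {x\<in>C a. l a x = 1}) \<union> {x\<in>C a. l a x = 1})) T h'"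
      using contract_on_closed[OF X PWc(1) h1M S1 h1(4) Ca(1) h1P Ca(2,3) Z1] by blast
    have eq: "S \<union> (\<Union>a\<in>insert a J. {x\<in>C a. l a x = 1}) =
        S \<union> (\<Union>a\<in>J. {x\<in>C a. l a x = 1}) \<union> {x\<in>C a. l a x = 1}"
      by auto
    show ?case
    proof (intro exI conjI)
      show "homotopic_with (\<lambda>u. \<forall>x\<in>Z. u x = v x) X M h h'"
        using h1(1) h'(1) homotopic_with_trans by blast
      show "\<forall>x\<in>topspace X - (\<Union>a\<in>insert a J. C a). h' x = h x"
        using h1(2) h'(2) by auto
      show "\<forall>x\<in>topspace X. (x, h' x) \<in> Q"
      proof
        fix x assume x: "x \<in> topspace X"
        show "(x, h' x) \<in> Q"
          using h'(2)[of x] h'(3) h1(3) PWc(3) x by (cases "x \<in> C a") auto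
      qed
      show "continuous_map (subtopology X (S \<union> (\<Union>a\<in>insert a J. {x\<in>C a. l a x = 1}))) T h'"
        using h'(4) unfolding eq .
    qed
  qed
qed

text \<open>The set \<open>Q'\<close> of admissible positions is so narrow that every map with graph in \<open>Q'\<close>
  can be moved through the contractions of all \<open>n\<close> colours, one colour after the other,
  with its graph staying in \<open>Q\<close>.\<close>

definition colored_control ::
    "'x topology \<Rightarrow> 'a topology \<Rightarrow> 'a topology \<Rightarrow> 'j itself \<Rightarrow> nat \<Rightarrow> 'x set set \<Rightarrow>
     ('x \<times> 'a) set \<Rightarrow> ('x \<times> 'a) set \<Rightarrow> bool" where
  "colored_control X T M _ n \<U> Q' Q \<longleftrightarrow>
     (\<forall>(J :: 'j set) col C l h S Z v.
        bump_family X n J col C l \<longrightarrow> (\<forall>a\<in>J. \<exists>U\<in>\<U>. C a \<subseteq> U) \<longrightarrow>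
        continuous_map X M h \<longrightarrow> (\<forall>x\<in>topspace X. (x, h x) \<in> Q') \<longrightarrow>
        closedin X S \<longrightarrow> continuous_map (subtopology X S) T h \<longrightarrow>
        (\<forall>x\<in>Z. x \<in> topspace X \<and> (\<forall>a\<in>J. l a x = 0) \<and> h x = v x) \<longrightarrow>
        (\<exists>h'. homotopic_with (\<lambda>u. \<forall>x\<in>Z. u x = v x) X M h h' \<and>
           (\<forall>x\<in>topspace X. (x, h' x) \<in> Q) \<and>
           continuous_map (subtopology X (S \<union> (\<Union>a\<in>J. {x\<in>C a. l a x = 1}))) T h'))"

text \<open>Backward choice, by induction on the number of colours.
  \<open>contraction_control\<close> prepares the last colour: its contractions lead from
  \<open>Q1\<close> into \<open>Q\<close>. The induction hypothesis, with target \<open>Q1\<close>,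
  prepares the earlier colours. The choices are made before any bump family is given.\<close>

lemma colored_control_exists:
  assumes X: "compact_space X" "regular_space X" and f: "continuous_map X M f"
    and lc: "locally_contracting T M"
    and "openin (prod_topology X M) Q" and "\<And>x. x \<in> topspace X \<Longrightarrow> (x, f x) \<in> Q"
  shows "\<exists>Q' \<U>. (\<forall>x\<in>topspace X. (x, f x) \<in> Q') \<and>
           (\<forall>U\<in>\<U>. openin X U) \<and> topspace X \<subseteq> \<Union>\<U> \<and> colored_control X T M TYPE('j) n \<U> Q' Q"
  using assms(5,6)
proof (induction n arbitrary: Q)
  case 0
  have "colored_control X T M TYPE('j) 0 {topspace X} Q Q"
    unfolding colored_control_def
  proof (intro allI impI)
    fix J :: "'j set" and col C l h S Z and v :: "'a \<Rightarrow> 'b"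
    assume "bump_family X 0 J col C l"
    then have "J = {}"
      by (auto simp: bump_family_def)
    moreover assume "continuous_map X M h" "\<forall>x\<in>topspace X. (x, h x) \<in> Q"
      "continuous_map (subtopology X S) T h"
      "\<forall>x\<in>Z. x \<in> topspace X \<and> (\<forall>a\<in>J. l a x = 0) \<and> h x = v x"
    ultimately show "\<exists>h'. homotopic_with (\<lambda>u. \<forall>x\<in>Z. u x = v x) X M h h' \<and>
        (\<forall>x\<in>topspace X. (x, h' x) \<in> Q) \<and>
        continuous_map (subtopology X (S \<union> (\<Union>a\<in>J. {x\<in>C a. l a x = 1}))) T h'"
      by (intro exI[of _ h] conjI) (simp_all add: homotopic_with_refl)
  qed
  then show ?case
    using 0(2) by (intro exI[of _ Q] exI[of _ "{topspace X}"] conjI) simp_all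
next
  case (Suc n)
  obtain Q1 \<U>1 where Q1: "openin (prod_topology X M) Q1" "Q1 \<subseteq> Q"
      "\<And>x. x \<in> topspace X \<Longrightarrow> (x, f x) \<in> Q1"
    and \<U>1: "\<And>U. U \<in> \<U>1 \<Longrightarrow> openin X U" "topspace X \<subseteq> \<Union>\<U>1"
    and contr: "\<And>U. U \<in> \<U>1 \<Longrightarrow> \<exists>P W c. local_contraction T M P W c \<and>
           (\<forall>x\<in>U. \<forall>p. (x, p) \<in> Q1 \<longrightarrow> p \<in> P) \<and> U \<times> W \<subseteq> Q"
    by (rule contraction_control[OF X f lc Suc.prems(1)], erule Suc.prems(2), rule that)
  obtain Q' \<U>2 where Q': "\<forall>x\<in>topspace X. (x, f x) \<in> Q'"
    and \<U>2: "\<forall>U\<in>\<U>2. openin X U" "topspace X \<subseteq> \<Union>\<U>2"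
    and cc: "colored_control X T M TYPE('j) n \<U>2 Q' Q1"
    using Suc.IH[OF Q1(1,3)] by blast
  \<comment> \<open>Members of the common refinement are small enough for both stages: they lie in a
    member of \<U>2 for the colours below \<open>n\<close>, and in a member of \<U>1 for the colour
    \<open>n\<close>.\<close>
  define \<U> where "\<U> = {U1 \<inter> U2 | U1 U2. U1 \<in> \<U>1 \<and> U2 \<in> \<U>2}"
  have "\<forall>U\<in>\<U>. openin X U"
    unfolding \<U>_def using \<U>1(1) \<U>2(1) by (blast intro: openin_Int)
  moreover have "x \<in> \<Union>\<U>" if "x \<in> topspace X" for x
  proof -
    obtain U1 U2 where "U1 \<in> \<U>1" "U2 \<in> \<U>2" "x \<in> U1 \<inter> U2"
      using \<open>x \<in> topspace X\<close> \<U>1(2) \<U>2(2) by blast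
    then show ?thesis
      unfolding \<U>_def by blast
  qed
  moreover have "colored_control X T M TYPE('j) (Suc n) \<U> Q' Q"
    unfolding colored_control_def
  proof (intro allI impI)
    fix J :: "'j set" and col C l h S Z and v :: "'a \<Rightarrow> 'b"
    assume bump: "bump_family X (Suc n) J col C l" and sub: "\<forall>a\<in>J. \<exists>U\<in>\<U>. C a \<subseteq> U"
      and h: "continuous_map X M h" "\<forall>x\<in>topspace X. (x, h x) \<in> Q'"
      and S: "closedin X S" "continuous_map (subtopology X S) T h"
      and Z: "\<forall>x\<in>Z. x \<in> topspace X \<and> (\<forall>a\<in>J. l a x = 0) \<and> h x = v x"
    define J0 where "J0 = {a \<in> J. col a < n}"
    define J1 where "J1 = {a \<in> J. col a = n}"
    have bump0: "bump_family X n J0 col C l" and bump1: "bump_family X (Suc n) J1 col C l"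
      using bump by (auto simp: bump_family_def J0_def J1_def)
    have J: "J = J0 \<union> J1"
      using bump by (auto simp: bump_family_def J0_def J1_def)
    have "\<exists>U1\<in>\<U>1. \<exists>U2\<in>\<U>2. C a \<subseteq> U1 \<and> C a \<subseteq> U2" if "a \<in> J" for a
      using bspec[OF sub that] unfolding \<U>_def by blast
    then have sub0: "\<forall>a\<in>J0. \<exists>U\<in>\<U>2. C a \<subseteq> U" and sub1: "\<And>a. a \<in> J1 \<Longrightarrow> \<exists>U\<in>\<U>1. C a \<subseteq> U"
      unfolding J0_def J1_def by blast+
    have Z0: "\<forall>x\<in>Z. x \<in> topspace X \<and> (\<forall>a\<in>J0. l a x = 0) \<and> h x = v x"
      using Z by (simp add: J0_def)
    obtain h1 where h1: "homotopic_with (\<lambda>u. \<forall>x\<in>Z. u x = v x) X M h h1"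
        "\<forall>x\<in>topspace X. (x, h1 x) \<in> Q1"
        "continuous_map (subtopology X (S \<union> (\<Union>a\<in>J0. {x\<in>C a. l a x = 1}))) T h1"
      using cc[unfolded colored_control_def, THEN spec[of _ J0], THEN spec[of _ col], THEN spec[of _ C],
          THEN spec[of _ l], THEN spec[of _ h], THEN spec[of _ S], THEN spec[of _ Z], THEN spec[of _ v],
          THEN mp, OF bump0, THEN mp, OF sub0, THEN mp, OF h(1), THEN mp, OF h(2), THEN mp, OF S(1),
          THEN mp, OF S(2), THEN mp, OF Z0] by (elim exE conjE)
    have S1: "closedin X (S \<union> (\<Union>a\<in>J0. {x\<in>C a. l a x = 1}))"
    proof (intro closedin_Un closedin_Union S(1))
      show "finite ((\<lambda>a. {x\<in>C a. l a x = 1}) ` J0)"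
        using bump0 by (simp add: bump_family_def)
    qed (use bump_family_closedin[OF bump0] in blast)
    \<comment> \<open>It suffices that the graph of \<open>h1\<close> lies in \<open>Q1\<close>:
      over \<open>U\<close> this forces the values into \<open>P\<close>, however far
      \<open>h1\<close> has moved away from \<open>f\<close>.\<close>
    have contr1: "\<exists>P W c. local_contraction T M P W c \<and> h1 ` C a \<subseteq> P \<and> C a \<times> W \<subseteq> Q"
      if a: "a \<in> J1" for a
    proof -
      obtain U where U: "U \<in> \<U>1" "C a \<subseteq> U"
        using sub1[OF a] by blast
      obtain P W c where P: "local_contraction T M P W c" "\<forall>x\<in>U. \<forall>p. (x, p) \<in> Q1 \<longrightarrow> p \<in> P"
          "U \<times> W \<subseteq> Q"
        using contr[OF U(1)] by blast
      have "closedin X (C a)"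
        using bump1 a by (simp add: bump_family_def)
      then have "C a \<subseteq> topspace X"
        by (rule closedin_subset)
      then have "h1 ` C a \<subseteq> P"
        using P(2) U(2) h1(2) by blast
      moreover have "C a \<times> W \<subseteq> Q"
        using P(3) U(2) by blast
      ultimately show ?thesis
        using P(1) by (intro exI[of _ P] exI[of _ W] exI[of _ c]) simp
    qed
    have Z1: "x \<in> topspace X \<and> (\<forall>a\<in>J1. l a x = 0) \<and> h1 x = v x" if "x \<in> Z" for x
      using bspec[OF Z that] homotopic_with_imp_property[OF h1(1)] that by (simp add: J1_def)
    have h1M: "continuous_map X M h1"
      using homotopic_with_imp_continuous_maps[OF h1(1)] by blast
    have same: "col a = col b" if "a \<in> J1" "b \<in> J1" for a b
      using that by (simp add: J1_def)
    have h1Q: "(x, h1 x) \<in> Q" if "x \<in> topspace X" for x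
      using that h1(2) Q1(2) by blast
    obtain h' where h': "homotopic_with (\<lambda>u. \<forall>x\<in>Z. u x = v x) X M h1 h'"
        "\<forall>x\<in>topspace X. (x, h' x) \<in> Q"
        "continuous_map (subtopology X (S \<union> (\<Union>a\<in>J0. {x\<in>C a. l a x = 1}) \<union>
           (\<Union>a\<in>J1. {x\<in>C a. l a x = 1}))) T h'"
      using contract_on_disjoint[where Z = Z, OF X(1) bump1 same h1M S1 h1(3) h1Q contr1 Z1]
      by auto
    have eq: "S \<union> (\<Union>a\<in>J. {x\<in>C a. l a x = 1}) = S \<union> (\<Union>a\<in>J0. {x\<in>C a. l a x = 1}) \<union>
           (\<Union>a\<in>J1. {x\<in>C a. l a x = 1})"
      by (auto simp: J)
    show "\<exists>h'. homotopic_with (\<lambda>u. \<forall>x\<in>Z. u x = v x) X M h h' \<and>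
        (\<forall>x\<in>topspace X. (x, h' x) \<in> Q) \<and>
        continuous_map (subtopology X (S \<union> (\<Union>a\<in>J. {x\<in>C a. l a x = 1}))) T h'"
      unfolding eq using h'(2,3) homotopic_with_trans[OF h1(1) h'(1)]
      by (intro exI[of _ h'] conjI)
  qed
  ultimately show ?case
    using Q' by blast
qed

section \<open>Coloured bump functions on cubes\<close>

lemma topspace_cube: "topspace (cube k) = {..<k} \<rightarrow>\<^sub>E {0..1}"
  by (simp add: cube_def)

lemma compact_space_cube: "compact_space (cube k)"
  by (simp add: cube_def compact_space_product_topology compact_space_subtopology)

lemma regular_space_cube: "regular_space (cube k)"
  using compact_space_cube unfolding cube_def
  by (intro compact_Hausdorff_imp_regular_space)
    (auto simp: Hausdorff_space_product_topology Hausdorff_space_subtopology)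

lemma continuous_map_cube_coordinate:
  assumes "i < k"
  shows "continuous_map (cube k) euclideanreal (\<lambda>x. x i)"
proof -
  have "continuous_map (cube k) unit_interval (\<lambda>x. x i)"
    unfolding cube_def using assms by (intro continuous_map_product_projection) simp
  then show ?thesis
    by (simp add: continuous_map_in_subtopology)
qed

lemma openin_cube_contains_box:
  assumes U: "openin (cube k) U" and x: "x \<in> U"
  obtains d where "d > 0" and "\<And>y. y \<in> topspace (cube k) \<Longrightarrow> (\<And>i. i < k \<Longrightarrow> \<bar>y i - x i\<bar> < d) \<Longrightarrow> y \<in> U"
proof -
  obtain V where V: "\<forall>i\<in>{..<k}. openin (top_of_set {0..1::real}) (V i)" "x \<in> PiE {..<k} V"
      "PiE {..<k} V \<subseteq> U"
    using U[unfolded cube_def openin_product_topology_alt, THEN bspec, OF x] by blast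
  have "\<exists>e. e > 0 \<and> ball (x i) e \<inter> {0..1} \<subseteq> V i" if "i < k" for i
  proof -
    have "openin (top_of_set {0..1}) (V i)" "x i \<in> V i"
      using V(1,2) that by auto
    then show ?thesis
      unfolding openin_contains_ball by blast
  qed
  then have "\<forall>i\<in>{..<k}. \<exists>e. e > 0 \<and> ball (x i) e \<inter> {0..1} \<subseteq> V i"
    by simp
  from bchoice[OF this] obtain e where "\<forall>i\<in>{..<k}. e i > 0 \<and> ball (x i) (e i) \<inter> {0..1} \<subseteq> V i" ..
  then have e: "e i > 0" "ball (x i) (e i) \<inter> {0..1} \<subseteq> V i" if "i < k" for i
    using that by simp_all
  \<comment> \<open>For \<open>k = 0\<close> there are no coordinates; the inserted 1 keeps the
    minimum meaningful.\<close>
  define d where "d = Min (insert 1 (e ` {..<k}))"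
  show thesis
  proof
    show "d > 0"
      using e(1) by (auto simp: d_def)
    fix y assume y: "y \<in> topspace (cube k)" "\<And>i. i < k \<Longrightarrow> \<bar>y i - x i\<bar> < d"
    have "y i \<in> V i" if "i < k" for i
    proof -
      have "d \<le> e i"
        unfolding d_def using that by (intro Min_le) auto
      then have "y i \<in> ball (x i) (e i)"
        using y(2)[OF that] by (simp add: dist_real_def abs_minus_commute)
      moreover have "y i \<in> {0..1}"
        using y(1) that unfolding topspace_cube by (blast intro: PiE_mem)
      ultimately show ?thesis
        using e(2)[OF that] by blast
    qed
    then have "y \<in> PiE {..<k} V"
      using y(1) by (simp add: topspace_cube PiE_iff)
    then show "y \<in> U"
      using V(3) by blast
  qed
qed

text \<open>A Lebesgue number for the maximum distance of coordinates. By compactness the cube is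
  covered by finitely many boxes whose doubles still lie in members of the cover; a bound below all
  their radii works by the triangle inequality.\<close>

lemma cube_lebesgue_number:
  assumes op: "\<And>U. U \<in> \<U> \<Longrightarrow> openin (cube k) U" and cov: "topspace (cube k) \<subseteq> \<Union>\<U>"
  obtains d where "d > 0"
    and "\<And>x. x \<in> topspace (cube k) \<Longrightarrow>
           \<exists>U\<in>\<U>. \<forall>y\<in>topspace (cube k). (\<forall>i<k. \<bar>y i - x i\<bar> < d) \<longrightarrow> y \<in> U"
proof -
  define box where "box x d = {y \<in> topspace (cube k). \<forall>i<k. \<bar>y i - x i\<bar> < d}" for x :: "nat \<Rightarrow> real" and d
  have op_box: "openin (cube k) (box x d)" for x d
  proof -
    have "openin (cube k) {y \<in> topspace (cube k). y i \<in> ball (x i) d}" if "i < k" for i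
      using continuous_map_cube_coordinate[OF that] by (rule openin_continuous_map_preimage) simp
    then have "openin (cube k) (topspace (cube k) \<inter> (\<Inter>i\<in>{..<k}. {y \<in> topspace (cube k). y i \<in> ball (x i) d}))"
      by (cases "k = 0") (auto intro!: openin_Int openin_Inter)
    also have "\<dots> = box x d"
      by (auto simp: box_def dist_real_def abs_minus_commute)
    finally show ?thesis .
  qed
  define good where "good x d \<longleftrightarrow> d > 0 \<and> (\<exists>U\<in>\<U>. box x (2 * d) \<subseteq> U)" for x d
  have "\<exists>d. good x d \<and> x \<in> box x d" if x: "x \<in> topspace (cube k)" for x
  proof -
    obtain U where U: "U \<in> \<U>" "x \<in> U"
      using cov x by blast
    obtain d where d: "d > 0" "\<And>y. y \<in> topspace (cube k) \<Longrightarrow> (\<And>i. i < k \<Longrightarrow> \<bar>y i - x i\<bar> < d) \<Longrightarrow> y \<in> U"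
      using openin_cube_contains_box[OF op[OF U(1)] U(2)] by blast
    have "box x (2 * (d / 2)) \<subseteq> U"
      using d(2) by (auto simp: box_def)
    then show ?thesis
      using U(1) d(1) x by (intro exI[of _ "d / 2"]) (auto simp: good_def box_def)
  qed
  then have "topspace (cube k) \<subseteq> \<Union>{box x d | x d. good x d}"
    by blast
  moreover have "compactin (cube k) (topspace (cube k))"
    using compact_space_cube by (simp add: compact_space_def)
  moreover have "openin (cube k) B" if "B \<in> {box x d | x d. good x d}" for B
    using that op_box by blast
  ultimately obtain \<F> where \<F>: "finite \<F>" "\<F> \<subseteq> {box x d | x d. good x d}" "topspace (cube k) \<subseteq> \<Union>\<F>"
    using compactinD[of "cube k" "topspace (cube k)" "{box x d | x d. good x d}"] by blast
  have "\<forall>B\<in>\<F>. \<exists>x d. B = box x d \<and> good x d"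
    using \<F>(2) by blast
  then obtain c r where cr: "\<And>B. B \<in> \<F> \<Longrightarrow> B = box (c B) (r B) \<and> good (c B) (r B)"
    by metis
  define d where "d = Min (insert 1 (r ` \<F>))"
  show thesis
  proof
    have "r B > 0" if "B \<in> \<F>" for B
      using cr[OF that] by (simp add: good_def)
    then show "d > 0"
      using \<F>(1) by (auto simp: d_def)
    fix x assume x: "x \<in> topspace (cube k)"
    obtain B where B: "B \<in> \<F>" "x \<in> B"
      using \<F>(3) x by blast
    have dB: "d \<le> r B"
      unfolding d_def using \<F>(1) B(1) by (intro Min_le) auto
    obtain U where U: "U \<in> \<U>" "box (c B) (2 * r B) \<subseteq> U"
      using cr[OF B(1)] by (auto simp: good_def)
    have xB: "\<forall>i<k. \<bar>x i - c B i\<bar> < r B"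
      using B(2) cr[OF B(1)] by (auto simp: box_def)
    have "y \<in> U" if "y \<in> topspace (cube k)" "\<forall>i<k. \<bar>y i - x i\<bar> < d" for y
    proof -
      have "\<bar>y i - c B i\<bar> < 2 * r B" if "i < k" for i
      proof -
        have "\<bar>y i - x i\<bar> < d" "\<bar>x i - c B i\<bar> < r B"
          using that xB \<open>\<forall>i<k. \<bar>y i - x i\<bar> < d\<close> by simp_all
        then show ?thesis
          using dB by linarith
      qed
      then have "y \<in> box (c B) (2 * r B)"
        using \<open>y \<in> topspace (cube k)\<close> by (simp add: box_def)
      then show ?thesis
        using U(2) by blast
    qed
    then show "\<exists>U\<in>\<U>. \<forall>y\<in>topspace (cube k). (\<forall>i<k. \<bar>y i - x i\<bar> < d) \<longrightarrow> y \<in> U"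
      using U(1) by blast
  qed
qed

text \<open>The closed boxes are the cells of a fine grid, slightly enlarged; two of them with the same
  parity pattern of indices are disjoint, so the number of colours is independent of the mesh.\<close>

lemma cube_bump_cover:
  "\<exists>n. \<forall>\<U>. (\<forall>U\<in>\<U>. openin (cube k) U) \<longrightarrow> topspace (cube k) \<subseteq> \<Union>\<U> \<longrightarrow>
     (\<exists>(J :: (nat \<Rightarrow> nat) set) col C l. bump_family (cube k) n J col C l \<and>
        (\<forall>a\<in>J. \<exists>U\<in>\<U>. C a \<subseteq> U) \<and> topspace (cube k) \<subseteq> (\<Union>a\<in>J. {x \<in> C a. l a x = 1}))"
proof -
  \<comment> \<open>The \<open>2 ^ k\<close> parity patterns are the colours; \<open>e\<close>
    numbers them from 0 on.\<close>
  define B where "B = {..<k} \<rightarrow>\<^sub>E {..<2::nat}"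
  have "finite B"
    unfolding B_def by (intro finite_PiE) auto
  then obtain e where e: "bij_betw e B {0..<card B}"
    using ex_bij_betw_finite_nat by blast
  define par where "par a = restrict (\<lambda>i. a i mod 2) {..<k}" for a :: "nat \<Rightarrow> nat"
  have par: "par a \<in> B" for a
    by (auto simp: par_def B_def)
  have "\<exists>(J :: (nat \<Rightarrow> nat) set) col C l. bump_family (cube k) (card B) J col C l \<and>
        (\<forall>a\<in>J. \<exists>U\<in>\<U>. C a \<subseteq> U) \<and> topspace (cube k) \<subseteq> (\<Union>a\<in>J. {x \<in> C a. l a x = 1})"
    if op: "\<forall>U\<in>\<U>. openin (cube k) U" and cov: "topspace (cube k) \<subseteq> \<Union>\<U>" for \<U>
  proof -
    obtain d where d: "d > 0" "\<And>x. x \<in> topspace (cube k) \<Longrightarrow>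
           \<exists>U\<in>\<U>. \<forall>y\<in>topspace (cube k). (\<forall>i<k. \<bar>y i - x i\<bar> < d) \<longrightarrow> y \<in> U"
      by (rule cube_lebesgue_number[OF bspec[OF op] cov], assumption, rule that)
    obtain m where m: "1 / real (Suc m) < d"
      using nat_approx_posE[OF d(1)] by blast
    define N where "N = Suc m"
    have N: "N > 0" "1 / real N < d"
      using m by (simp_all add: N_def)
    define J where "J = {..<k} \<rightarrow>\<^sub>E {..<N}"
    \<comment> \<open>The index \<open>a\<close> stands for the grid cell with centre
      \<open>(a i + 1/2) / N\<close>, which in units of \<open>1 / N\<close> has half-width 1/2. The
      half-width 5/6 exceeds 1/2, which leaves room for a bump, and is below 1, so that boxes with
      centres 2 apart are disjoint and each box stays within \<open>1 / N < d\<close> of its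
      centre.\<close>
    define C where "C a = {x \<in> topspace (cube k). \<forall>i<k. \<bar>real N * x i - a i - 1/2\<bar> \<le> 5/6}" for a :: "nat \<Rightarrow> nat"
    \<comment> \<open>A trapezoid: 1 for \<open>\<bar>u\<bar> \<le> 1/2\<close>, 0 for
      \<open>\<bar>u\<bar> \<ge> 5/6\<close>, linear between. So the product \<open>l a\<close> is 1
      on the cell and 0 off the box.\<close>
    define b where "b u = max 0 (min 1 (5/2 - 3 * \<bar>u\<bar>))" for u :: real
    define l where "l a x = (\<Prod>i<k. b (real N * x i - a i - 1/2))" for a :: "nat \<Rightarrow> nat" and x :: "nat \<Rightarrow> real"
    have coord: "continuous_map (cube k) euclideanreal (\<lambda>x. real N * x i - a i - 1/2)"
      if "i < k" for i and a :: "nat \<Rightarrow> nat"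
      using continuous_map_cube_coordinate[OF that]
      by (intro continuous_map_diff continuous_map_real_mult_left) auto
    have b01: "0 \<le> b u" "b u \<le> 1" for u
      by (auto simp: b_def)
    have b_cont: "continuous_map euclideanreal euclideanreal b"
      unfolding b_def by (auto intro!: continuous_intros)
    have bump: "bump_family (cube k) (card B) J (\<lambda>a. e (par a)) C l"
      unfolding bump_family_def
    proof (intro conjI ballI impI)
      show "finite J"
        unfolding J_def by (intro finite_PiE) auto
      show "e (par a) < card B" for a
        using bij_betwE[OF e] par by fastforce
      show "closedin (cube k) (C a)" for a
      proof -
        have "closedin (cube k) {x \<in> topspace (cube k). real N * x i - a i - 1/2 \<in> cball 0 (5/6)}" if "i < k" for i
          using coord[OF that] by (rule closedin_continuous_map_preimage) simp
        then have "closedin (cube k) (\<Inter>(insert (topspace (cube k))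
            ((\<lambda>i. {x \<in> topspace (cube k). real N * x i - a i - 1/2 \<in> cball 0 (5/6)}) ` {..<k})))"
          by (intro closedin_Inter) auto
        also have "\<dots> = C a"
          unfolding C_def by auto
        finally show ?thesis .
      qed
      show "continuous_map (cube k) unit_interval (l a)" for a
      proof -
        have "continuous_map (cube k) euclideanreal (\<lambda>x. b (real N * x i - a i - 1/2))" if "i < k" for i
          using continuous_map_compose[OF coord[OF that] b_cont] by (simp add: o_def)
        then have "continuous_map (cube k) euclideanreal (l a)"
          unfolding l_def by (intro continuous_map_prod) auto
        moreover have "l a x \<in> {0..1}" for x
          using b01 by (simp add: l_def prod_nonneg prod_le_1)
        ultimately show ?thesis
          by (auto simp: continuous_map_in_subtopology)
      qed
      show "l a x = 0" if x: "x \<in> topspace (cube k) - C a" for a x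
      proof -
        obtain i where i: "i < k" "\<bar>real N * x i - a i - 1/2\<bar> > 5/6"
          using x unfolding C_def by (auto simp: not_le)
        then have "b (real N * x i - a i - 1/2) = 0"
          by (simp add: b_def)
        then show ?thesis
          using i(1) unfolding l_def by (intro prod_zero) auto
      qed
      show "C a1 \<inter> C a2 = {}" if a: "a1 \<in> J" "a2 \<in> J" "a1 \<noteq> a2 \<and> e (par a1) = e (par a2)" for a1 a2
      proof -
        have "par a1 = par a2"
          using a(3) par inj_onD[OF bij_betw_imp_inj_on[OF e]] by blast
        obtain i where i: "i < k" "a1 i \<noteq> a2 i"
          using a PiE_ext[of a1 "{..<k}" "\<lambda>_. {..<N}" a2] unfolding J_def by blast
        have "a1 i mod 2 = a2 i mod 2"
          using fun_cong[OF \<open>par a1 = par a2\<close>, of i] i(1) by (simp add: par_def)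
        \<comment> \<open>Distinct indices of equal parity differ by at least 2, and 5/6 + 5/6 <
          2.\<close>
        then have "a2 i \<noteq> Suc (a1 i)" "a1 i \<noteq> Suc (a2 i)"
          by (auto simp: mod_Suc split: if_splits)
        then have "a1 i + 2 \<le> a2 i \<or> a2 i + 2 \<le> a1 i"
          using i(2) by linarith
        then have *: "real (a1 i) + 2 \<le> real (a2 i) \<or> real (a2 i) + 2 \<le> real (a1 i)"
          by linarith
        have False if "x \<in> C a1" "x \<in> C a2" for x
        proof -
          have "\<bar>real N * x i - a1 i - 1/2\<bar> \<le> 5/6" "\<bar>real N * x i - a2 i - 1/2\<bar> \<le> 5/6"
            using that i(1) by (auto simp: C_def)
          then show False
            using * by linarith
        qed
        then show ?thesis
          by blast
      qed
    qed
    moreover have "\<exists>U\<in>\<U>. C a \<subseteq> U" if a: "a \<in> J" for a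
    proof -
      define x where "x = restrict (\<lambda>i. (a i + 1/2) / N) {..<k}"
      have "(a i + 1/2) / N \<in> {0..1}" if "i < k" for i
      proof -
        have "a i < N"
          using a that by (auto simp: J_def)
        then have "real (a i) + 1 \<le> real N"
          by linarith
        then show ?thesis
          using N(1) by (simp add: field_simps)
      qed
      then have "x \<in> topspace (cube k)"
        by (auto simp: x_def topspace_cube)
      then obtain U where U: "U \<in> \<U>" "\<forall>y\<in>topspace (cube k). (\<forall>i<k. \<bar>y i - x i\<bar> < d) \<longrightarrow> y \<in> U"
        using d(2) by blast
      have "y \<in> U" if y: "y \<in> C a" for y
      proof -
        have "\<bar>y i - x i\<bar> < d" if "i < k" for i
        proof -
          have "\<bar>real N * y i - a i - 1/2\<bar> \<le> 5/6"
            using y that by (auto simp: C_def)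
          moreover have "real N * y i - a i - 1/2 = real N * (y i - x i)"
            using N(1) that by (simp add: x_def field_simps)
          ultimately have "real N * \<bar>y i - x i\<bar> \<le> 5/6"
            by (simp add: abs_mult)
          then have "\<bar>y i - x i\<bar> \<le> (5/6) / N"
            using N(1) by (simp add: field_simps)
          also have "\<dots> \<le> 1 / N"
            using N(1) by (simp add: field_simps)
          finally show ?thesis
            using N(2) by linarith
        qed
        then show ?thesis
          using U(2) y by (auto simp: C_def)
      qed
      then show ?thesis
        using U(1) by blast
    qed
    moreover have "\<exists>a\<in>J. x \<in> C a \<and> l a x = 1" if x: "x \<in> topspace (cube k)" for x
    proof -
      \<comment> \<open>A cell that contains \<open>x\<close>. The minimum with \<open>N - 1\<close>
        matters for \<open>x i = 1\<close>, which lies on the far face of the last cell.\<close>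
      define a where "a = restrict (\<lambda>i. min (nat \<lfloor>real N * x i\<rfloor>) (N - 1)) {..<k}"
      have near: "\<bar>real N * x i - a i - 1/2\<bar> \<le> 1/2" if "i < k" for i
      proof -
        have x01: "0 \<le> x i" "x i \<le> 1"
          using x that by (auto simp: topspace_cube PiE_iff)
        then have Nx: "0 \<le> real N * x i" "real N * x i \<le> N"
          by (auto simp: mult_left_le)
        show ?thesis
        proof (cases "nat \<lfloor>real N * x i\<rfloor> \<le> N - 1")
          case True
          then have "real (a i) = of_int \<lfloor>real N * x i\<rfloor>"
            using that Nx by (simp add: a_def)
          then show ?thesis
            by linarith
        next
          case False
          then have "real (a i) = real N - 1"
            using that N(1) by (simp add: a_def of_nat_diff)
          moreover have "real N \<le> real N * x i"
            using False N(1) Nx by linarith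
          ultimately show ?thesis
            using Nx by linarith
        qed
      qed
      have "a \<in> J"
        using N(1) by (auto simp: a_def J_def)
      moreover have "x \<in> C a"
        using x near by (fastforce simp: C_def)
      moreover have "l a x = 1"
      proof -
        have "b (real N * x i - a i - 1/2) = 1" if "i < k" for i
          using near[OF that] by (simp add: b_def)
        then show ?thesis
          by (simp add: l_def)
      qed
      ultimately show ?thesis
        by blast
    qed
    then have "topspace (cube k) \<subseteq> (\<Union>a\<in>J. {x \<in> C a. l a x = 1})"
      by blast
    ultimately show ?thesis
      by blast
  qed
  then show ?thesis
    by blast
qed

section \<open>Weak homotopy equivalence from local contractions\<close>

text \<open>The bump functions of a fine grid are multiplied by \<open>mu\<close>. They then vanish
  on \<open>Z\<close>, which stays fixed, and are unchanged outside \<open>N\<close>; so the sets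
  where they are 1, together with \<open>N\<close>, on which \<open>f\<close> is
  \<open>T\<close>-continuous from the start, exhaust the cube. The product is again a bump family
  because \<open>bump_family\<close> does not ask for the value 1 anywhere.\<close>

lemma deform_cube_rel:
  assumes lc: "locally_contracting T M" and f: "continuous_map (cube k) M f"
    and N: "closedin (cube k) N" and fN: "continuous_map (subtopology (cube k) N) T f"
    and mu: "continuous_map (cube k) unit_interval mu"
    and mu1: "\<And>x. x \<in> topspace (cube k) - N \<Longrightarrow> mu x = 1"
    and Z: "\<And>x. x \<in> Z \<Longrightarrow> x \<in> topspace (cube k) \<and> mu x = 0"
  shows "\<exists>g. homotopic_with (\<lambda>u. \<forall>x\<in>Z. u x = f x) (cube k) M f g \<and> continuous_map (cube k) T g"
proof -
  obtain n where n: "\<forall>\<U>. (\<forall>U\<in>\<U>. openin (cube k) U) \<longrightarrow> topspace (cube k) \<subseteq> \<Union>\<U> \<longrightarrow>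
     (\<exists>(J :: (nat \<Rightarrow> nat) set) col C l. bump_family (cube k) n J col C l \<and>
        (\<forall>a\<in>J. \<exists>U\<in>\<U>. C a \<subseteq> U) \<and> topspace (cube k) \<subseteq> (\<Union>a\<in>J. {x \<in> C a. l a x = 1}))"
    using cube_bump_cover[of k] by (elim exE)
  \<comment> \<open>The final map is not constrained, so the backward choice starts from the whole
    product.\<close>
  define Q where "Q = topspace (prod_topology (cube k) M)"
  have fQ: "(x, f x) \<in> Q" if "x \<in> topspace (cube k)" for x
    using that f by (auto simp: Q_def continuous_map_def)
  have Q: "openin (prod_topology (cube k) M) Q"
    unfolding Q_def by (rule openin_topspace)
  have "\<exists>Q' \<U>. (\<forall>x\<in>topspace (cube k). (x, f x) \<in> Q') \<and> (\<forall>U\<in>\<U>. openin (cube k) U) \<and>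
      topspace (cube k) \<subseteq> \<Union>\<U> \<and> colored_control (cube k) T M TYPE(nat \<Rightarrow> nat) n \<U> Q' Q"
    by (rule colored_control_exists[OF compact_space_cube regular_space_cube f lc Q fQ])
  then obtain Q' \<U> where Q': "\<forall>x\<in>topspace (cube k). (x, f x) \<in> Q'"
    and \<U>: "\<forall>U\<in>\<U>. openin (cube k) U" "topspace (cube k) \<subseteq> \<Union>\<U>"
    and cc: "colored_control (cube k) T M TYPE(nat \<Rightarrow> nat) n \<U> Q' Q"
    by (elim exE conjE)
  obtain J :: "(nat \<Rightarrow> nat) set" and col C l where J: "bump_family (cube k) n J col C l"
      "\<forall>a\<in>J. \<exists>U\<in>\<U>. C a \<subseteq> U" "topspace (cube k) \<subseteq> (\<Union>a\<in>J. {x \<in> C a. l a x = 1})"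
    using n[THEN spec, THEN mp, OF \<U>(1), THEN mp, OF \<U>(2)] by (elim exE conjE)
  define l' where "l' a x = l a x * mu x" for a x
  have mur: "continuous_map (cube k) euclideanreal mu" and mu01: "\<And>x. x \<in> topspace (cube k) \<Longrightarrow> mu x \<in> {0..1}"
    using mu by (auto simp: continuous_map_in_subtopology Pi_iff)
  have J': "bump_family (cube k) n J col C l'"
    unfolding bump_family_def
  proof (intro conjI ballI impI)
    fix a assume a: "a \<in> J"
    have la: "continuous_map (cube k) unit_interval (l a)" "\<forall>x\<in>topspace (cube k) - C a. l a x = 0"
      using J(1) a by (simp_all add: bump_family_def)
    show "continuous_map (cube k) unit_interval (l' a)"
    proof (rule continuous_map_into_subtopology)
      have lr: "continuous_map (cube k) euclideanreal (l a)"
        and l01: "\<And>x. x \<in> topspace (cube k) \<Longrightarrow> l a x \<in> {0..1}"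
        using la(1) by (auto simp: continuous_map_in_subtopology Pi_iff)
      show "continuous_map (cube k) euclideanreal (l' a)"
        unfolding l'_def using lr mur by (rule continuous_map_real_mult)
      show "l' a \<in> topspace (cube k) \<rightarrow> {0..1}"
        using l01 mu01 by (simp add: Pi_iff l'_def mult_le_one)
    qed
    show "l' a x = 0" if "x \<in> topspace (cube k) - C a" for x
      using la(2) that by (simp add: l'_def)
  qed (use J(1) in \<open>simp_all add: bump_family_def\<close>)
  have Z': "\<forall>x\<in>Z. x \<in> topspace (cube k) \<and> (\<forall>a\<in>J. l' a x = 0) \<and> f x = f x"
    using Z by (simp add: l'_def)
  obtain g where g: "homotopic_with (\<lambda>u. \<forall>x\<in>Z. u x = f x) (cube k) M f g"
      "continuous_map (subtopology (cube k) (N \<union> (\<Union>a\<in>J. {x\<in>C a. l' a x = 1}))) T g"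
    using cc[unfolded colored_control_def, THEN spec[of _ J], THEN spec[of _ col], THEN spec[of _ C],
        THEN spec[of _ l'], THEN spec[of _ f], THEN spec[of _ N], THEN spec[of _ Z], THEN spec[of _ f],
        THEN mp, OF J', THEN mp, OF J(2), THEN mp, OF f, THEN mp, OF Q', THEN mp, OF N,
        THEN mp, OF fN, THEN mp, OF Z'] by (elim exE conjE)
  have "topspace (cube k) \<subseteq> N \<union> (\<Union>a\<in>J. {x\<in>C a. l' a x = 1})"
  proof
    fix x assume x: "x \<in> topspace (cube k)"
    then obtain a where a: "a \<in> J" "x \<in> C a" "l a x = 1"
      using J(3) by blast
    show "x \<in> N \<union> (\<Union>a\<in>J. {x\<in>C a. l' a x = 1})"
    proof (cases "x \<in> N")
      case False
      then have "l' a x = 1"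
        using a(3) mu1 x by (simp add: l'_def)
      then show ?thesis
        using a by blast
    qed simp
  qed
  then have "continuous_map (cube k) T g"
    using g(2) by (simp add: subtopology_superset)
  then show ?thesis
    using g(1) by blast
qed

text \<open>Stretching the middle half of each coordinate over \<open>[0, 1]\<close> turns a map that is
  constant on the boundary into one that is constant near it.\<close>

definition stretch :: "nat \<Rightarrow> real \<Rightarrow> (nat \<Rightarrow> real) \<Rightarrow> nat \<Rightarrow> real" where
  "stretch k s x = (\<lambda>i\<in>{..<k}. (1 - s) * x i + s * max 0 (min 1 (2 * x i - 1/2)))"

text \<open>The bounds 1/4 and 3/4 are where \<open>2 * x i - 1/2\<close> reaches 0 and 1, so that
  \<open>stretch k 1\<close> takes this closed set into the boundary.\<close>

definition collar :: "nat \<Rightarrow> (nat \<Rightarrow> real) set" where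
  "collar k = {x \<in> topspace (cube k). \<exists>i<k. x i \<le> 1/4 \<or> 3/4 \<le> x i}"

section \<open>Properties of the stretching map\<close>

lemma cube_coordinate_bounds:
  assumes "x \<in> topspace (cube k)" and "i < k"
  shows "0 \<le> x i" "x i \<le> 1"
  using PiE_mem[of x "{..<k}" "\<lambda>_. {0..1}" i] assms by (simp_all add: topspace_cube)

lemma stretch_in_cube:
  assumes x: "x \<in> topspace (cube k)" and s: "s \<in> {0..1}"
  shows "stretch k s x \<in> topspace (cube k)"
proof -
  have "(1 - s) * x i + s * max 0 (min 1 (2 * x i - 1/2)) \<in> {0..1}" if "i < k" for i
  proof -
    have "(1 - s) * x i + s * max 0 (min 1 (2 * x i - 1/2)) \<le> 1"
      using s cube_coordinate_bounds[OF x that] by (intro convex_bound_le) auto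
    moreover have "0 \<le> (1 - s) * x i + s * max 0 (min 1 (2 * x i - 1/2))"
      using s cube_coordinate_bounds[OF x that] by (intro add_nonneg_nonneg mult_nonneg_nonneg) auto
    ultimately show ?thesis
      by simp
  qed
  then show ?thesis
    unfolding topspace_cube stretch_def by (intro restrict_PiE_iff[THEN iffD2]) simp
qed

lemma stretch_0: "x \<in> topspace (cube k) \<Longrightarrow> stretch k 0 x = x"
  by (rule ext) (auto simp: stretch_def topspace_cube PiE_iff extensional_def)

lemma continuous_map_unit_intervalD:
  "continuous_map X unit_interval f \<Longrightarrow> continuous_map X euclideanreal f"
  by (simp add: continuous_map_in_subtopology)

lemma continuous_map_into_cube:
  assumes "\<And>i. i < k \<Longrightarrow> continuous_map X euclideanreal (\<lambda>x. f x i)"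
    and "\<And>x. x \<in> topspace X \<Longrightarrow> f x \<in> topspace (cube k)"
  shows "continuous_map X (cube k) f"
proof -
  have ext: "f ` topspace X \<subseteq> extensional {..<k}"
    using assms(2) by (auto simp: topspace_cube PiE_iff)
  have "continuous_map X unit_interval (\<lambda>x. f x i)" if "i < k" for i
  proof -
    have "f x i \<in> {0..1}" if "x \<in> topspace X" for x
      using cube_coordinate_bounds[OF assms(2)[OF that] \<open>i < k\<close>] by simp
    then show ?thesis
      using assms(1)[OF that] by (intro continuous_map_into_subtopology) auto
  qed
  then show ?thesis
    unfolding cube_def using ext by (auto simp: continuous_map_componentwise)
qed

lemma continuous_map_stretch:
  "continuous_map (prod_topology unit_interval (cube k)) (cube k) (\<lambda>(s, x). stretch k s x)"
proof (rule continuous_map_into_cube)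
  let ?X = "prod_topology unit_interval (cube k)"
  fix i assume i: "i < k"
  have 1: "continuous_map ?X euclideanreal (\<lambda>z. snd z i)"
    using continuous_map_compose[OF continuous_map_snd continuous_map_cube_coordinate[OF i]]
    by (simp add: o_def)
  have 2: "continuous_map ?X euclideanreal (\<lambda>z. fst z)"
    using continuous_map_fst by (intro continuous_map_unit_intervalD) 
  have "continuous_map ?X euclideanreal
      (\<lambda>z. (1 - fst z) * snd z i + fst z * max 0 (min 1 (2 * snd z i - 1/2)))"
    by (intro continuous_map_add continuous_map_diff continuous_map_real_mult continuous_map_real_max
        continuous_map_real_min 1 2) simp_all
  then show "continuous_map ?X euclideanreal (\<lambda>z. (case z of (s, x) \<Rightarrow> stretch k s x) i)"
    using i by (simp add: stretch_def case_prod_beta)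
qed (auto intro: stretch_in_cube)

lemma stretch_boundary:
  assumes x: "x \<in> cube_boundary k" and s: "s \<in> {0..1}"
  shows "stretch k s x \<in> cube_boundary k"
proof -
  obtain i where i: "x \<in> topspace (cube k)" "i < k" "x i = 0 \<or> x i = 1"
    using x by (auto simp: cube_boundary_def)
  have "stretch k s x i = x i"
    using i(2,3) by (auto simp: stretch_def)
  then show ?thesis
    using i stretch_in_cube[OF i(1) s] by (auto simp: cube_boundary_def)
qed

lemma stretch_collar:
  assumes x: "x \<in> collar k"
  shows "stretch k 1 x \<in> cube_boundary k"
proof -
  obtain i where i: "x \<in> topspace (cube k)" "i < k" "x i \<le> 1/4 \<or> 3/4 \<le> x i"
    using x by (auto simp: collar_def)
  have "stretch k 1 x i = 0 \<or> stretch k 1 x i = 1"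
    using i(2,3) by (auto simp: stretch_def)
  then show ?thesis
    using i stretch_in_cube[OF i(1), of 1] by (auto simp: cube_boundary_def)
qed

lemma continuous_map_stretch_1: "continuous_map (cube k) (cube k) (stretch k 1)"
proof -
  have "continuous_map (cube k) (prod_topology unit_interval (cube k)) (\<lambda>x. (1, x))"
    by (simp add: continuous_map_pairwise o_def)
  from continuous_map_compose[OF this continuous_map_stretch] show ?thesis
    by (simp add: o_def)
qed

text \<open>In each coordinate the stretching fixes 0 and 1 at every time \<open>s\<close>, so it
  maps every face to itself and gives a homotopy relative to the boundary.\<close>

lemma stretch_homotopy:
  assumes g: "g \<in> cube_maps k X p"
  shows "(g, g \<circ> stretch k 1) \<in> cube_homotopy k X p"
proof -
  have bd: "cube_boundary k \<subseteq> topspace (cube k)"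
    by (auto simp: cube_boundary_def)
  have gc: "continuous_map (cube k) X g" and gp: "\<And>x. x \<in> cube_boundary k \<Longrightarrow> g x = p"
    using g by (auto simp: cube_maps_def)
  have "homotopic_with (\<lambda>u. u ` cube_boundary k \<subseteq> {p}) (cube k) X g (g \<circ> stretch k 1)"
  proof (subst homotopic_with)
    show "(u ` cube_boundary k \<subseteq> {p}) = (v ` cube_boundary k \<subseteq> {p})"
      if "\<And>x. x \<in> topspace (cube k) \<Longrightarrow> u x = v x" for u v :: "(nat \<Rightarrow> real) \<Rightarrow> 'a"
      using that bd by (simp add: image_subset_iff subset_iff)
    show "\<exists>h. continuous_map (prod_topology unit_interval (cube k)) X h \<and>
        (\<forall>x\<in>topspace (cube k). h (0, x) = g x) \<and>
        (\<forall>x\<in>topspace (cube k). h (1, x) = (g \<circ> stretch k 1) x) \<and>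
        (\<forall>t\<in>{0..1}. (\<lambda>x. h (t, x)) ` cube_boundary k \<subseteq> {p})"
      using continuous_map_compose[OF continuous_map_stretch gc] gp stretch_boundary
      by (intro exI[of _ "g \<circ> (\<lambda>(s, x). stretch k s x)"]) (auto simp: stretch_0)
  qed
  then show ?thesis
    by (simp add: cube_homotopy_def)
qed

section \<open>Deformation relative to the boundary\<close>

lemma closedin_cube_le:
  assumes "i < k"
  shows "closedin (cube k) {x \<in> topspace (cube k). x i \<le> c}"
    and "closedin (cube k) {x \<in> topspace (cube k). c \<le> x i}"
  using closedin_continuous_map_preimage[OF continuous_map_cube_coordinate[OF assms], of "{..c}"]
    closedin_continuous_map_preimage[OF continuous_map_cube_coordinate[OF assms], of "{c..}"]
  by simp_all

lemma closedin_cube_sides: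
  assumes "m \<le> k"
  shows "closedin (cube k) {x \<in> topspace (cube k). \<exists>i<m. x i \<le> 1/4 \<or> 3/4 \<le> x i}"
proof -
  have "closedin (cube k) (\<Union>i\<in>{..<m}. {x \<in> topspace (cube k). x i \<le> 1/4} \<union> {x \<in> topspace (cube k). 3/4 \<le> x i})"
  proof (rule closedin_Union)
    fix B assume "B \<in> (\<lambda>i. {x \<in> topspace (cube k). x i \<le> 1/4} \<union> {x \<in> topspace (cube k). 3/4 \<le> x i}) ` {..<m}"
    then obtain i where "i < m" and B: "B = {x \<in> topspace (cube k). x i \<le> 1/4} \<union> {x \<in> topspace (cube k). 3/4 \<le> x i}"
      by blast
    then have "i < k"
      using assms by simp
    then show "closedin (cube k) B"
      unfolding B by (intro closedin_Un closedin_cube_le)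
  qed simp
  moreover have "(\<Union>i\<in>{..<m}. {x \<in> topspace (cube k). x i \<le> 1/4} \<union> {x \<in> topspace (cube k). 3/4 \<le> x i}) =
      {x \<in> topspace (cube k). \<exists>i<m. x i \<le> 1/4 \<or> 3/4 \<le> x i}"
    by blast
  ultimately show ?thesis
    by simp
qed

lemma deform_cube:
  assumes lc: "locally_contracting T M" and f: "continuous_map (cube k) M f"
    and fT: "continuous_map (subtopology (cube k) (collar k)) T f"
  shows "\<exists>g. homotopic_with (\<lambda>u. \<forall>x\<in>cube_boundary k. u x = f x) (cube k) M f g \<and>
           continuous_map (cube k) T g"
proof (rule deform_cube_rel[OF lc f _ fT])
  \<comment> \<open>The factor 4 lets \<open>b\<close> reach 1 at distance 1/4 from the end points,
    the width of the collar; so \<open>mu\<close> is 0 on the boundary and 1 outside the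
    collar.\<close>
  define b where "b u = max 0 (min 1 (4 * min u (1 - u)))" for u :: real
  define mu where "mu x = (\<Prod>i<k. b (x i))" for x :: "nat \<Rightarrow> real"
  show "closedin (cube k) (collar k)"
    using closedin_cube_sides[of k k] by (simp add: collar_def)
  have "continuous_map (cube k) euclideanreal (\<lambda>x. b (x i))" if "i < k" for i
    unfolding b_def using continuous_map_cube_coordinate[OF that]
    by (intro continuous_map_real_max continuous_map_real_min continuous_map_real_mult_left
        continuous_map_diff) simp_all
  then have "continuous_map (cube k) euclideanreal mu"
    unfolding mu_def by (intro continuous_map_prod) simp_all
  moreover have "mu x \<in> {0..1}" for x
  proof -
    have b01: "0 \<le> b u" "b u \<le> 1" for u
      by (simp_all add: b_def)
    then show ?thesis
      by (simp add: mu_def prod_nonneg prod_le_1)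
  qed
  ultimately show "continuous_map (cube k) unit_interval mu"
    by (intro continuous_map_into_subtopology) simp_all
  show "mu x = 1" if "x \<in> topspace (cube k) - collar k" for x
  proof -
    have "b (x i) = 1" if "i < k" for i
    proof -
      have "1/4 < x i" "x i < 3/4"
        using \<open>x \<in> topspace (cube k) - collar k\<close> that unfolding collar_def by force+
      then show ?thesis
        by (auto simp: b_def min_def max_def)
    qed
    then show ?thesis
      by (simp add: mu_def)
  qed
  show "x \<in> topspace (cube k) \<and> mu x = 0" if "x \<in> cube_boundary k" for x
  proof -
    obtain i where i: "i < k" "x i = 0 \<or> x i = 1"
      using \<open>x \<in> cube_boundary k\<close> by (auto simp: cube_boundary_def)
    then have "b (x i) = 0"
      by (auto simp: b_def)
    then have "mu x = 0"
      using i(1) unfolding mu_def by (intro prod_zero) auto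
    then show ?thesis
      using \<open>x \<in> cube_boundary k\<close> by (simp add: cube_boundary_def)
  qed
qed

section \<open>Surjectivity and injectivity on homotopy classes\<close>

lemma cube_maps_mono:
  assumes "continuous_map T M id" and "g \<in> cube_maps k T p"
  shows "g \<in> cube_maps k M p"
  using continuous_map_compose[of "cube k" T g M id] assms by (simp add: cube_maps_def)

text \<open>After stretching, the map is constant on the collar and hence
  \<open>T\<close>-continuous there, so it can be deformed relative to the boundary. The homotopy
  runs in \<open>M\<close>; only its end has to be \<open>T\<close>-continuous.\<close>

lemma homotopy_lifts_surj:
  assumes lc: "locally_contracting T M"
    and p: "p \<in> topspace T" and f: "f \<in> cube_maps k M p"
  shows "\<exists>g\<in>cube_maps k T p. (f, g) \<in> cube_homotopy k M p"
proof -
  define F where "F = f \<circ> stretch k 1"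
  have fF: "(f, F) \<in> cube_homotopy k M p"
    unfolding F_def by (rule stretch_homotopy[OF f])
  have Fp: "F x = p" if "x \<in> collar k" for x
    using stretch_collar[OF that] f by (auto simp: F_def cube_maps_def)
  have bd: "cube_boundary k \<subseteq> collar k"
    by (force simp: cube_boundary_def collar_def)
  have Fc: "continuous_map (cube k) M F"
    using f unfolding F_def cube_maps_def
    by (intro continuous_map_compose[OF continuous_map_stretch_1]) simp
  have "continuous_map (subtopology (cube k) (collar k)) T F"
    by (rule continuous_map_eq[where f = "\<lambda>x. p"]) (use p Fp in simp_all)
  from deform_cube[OF lc Fc this] obtain g
    where g: "homotopic_with (\<lambda>u. \<forall>x\<in>cube_boundary k. u x = F x) (cube k) M F g"
      "continuous_map (cube k) T g"
    by (elim exE conjE)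
  have "homotopic_with (\<lambda>u. u ` cube_boundary k \<subseteq> {p}) (cube k) M F g"
    using g(1) by (rule homotopic_with_mono) (use Fp bd in auto)
  then have Fg: "(F, g) \<in> cube_homotopy k M p"
    by (simp add: cube_homotopy_def)
  have "g \<in> cube_maps k T p"
    using g(2) homotopic_with_imp_property[OF g(1)] Fp bd by (auto simp: cube_maps_def)
  moreover have "(f, g) \<in> cube_homotopy k M p"
    using fF Fg homotopic_with_trans by (auto simp: cube_homotopy_def)
  ultimately show ?thesis
    by blast
qed

text \<open>A homotopy in \<open>M\<close> is read as a map on the cube of dimension
  \<open>k + 1\<close>, with the last coordinate as time, and deformed relative to the whole
  boundary. The deformed map keeps its boundary values and is therefore a homotopy in
  \<open>T\<close> between the stretched versions of \<open>g\<close> and \<open>h\<close>;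
  \<open>stretch_homotopy\<close>, used in \<open>T\<close>, leads back to \<open>g\<close> and
  \<open>h\<close>.\<close>

lemma homotopy_lifts_inj:
  assumes lc: "locally_contracting T M"
    and p: "p \<in> topspace T" and g: "g \<in> cube_maps k T p" and h: "h \<in> cube_maps k T p"
    and gh: "(g, h) \<in> cube_homotopy k M p"
  shows "(g, h) \<in> cube_homotopy k T p"
proof -
  have "homotopic_with (\<lambda>u. u ` cube_boundary k \<subseteq> {p}) (cube k) M g h"
    using gh by (simp add: cube_homotopy_def)
  then obtain H where H: "continuous_map (prod_topology unit_interval (cube k)) M H"
      "\<forall>x. H (0, x) = g x" "\<forall>x. H (1, x) = h x"
      "\<forall>t\<in>{0..1}. (\<lambda>x. H (t, x)) ` cube_boundary k \<subseteq> {p}"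
    unfolding homotopic_with_def by (elim exE conjE)
  have Hp: "H (t, x) = p" if "t \<in> {0..1}" "x \<in> cube_boundary k" for t x
    using bspec[OF H(4) that(1)] that(2) by blast
  define rst where "rst z = restrict z {..<k}" for z :: "nat \<Rightarrow> real"
  have rst: "rst z \<in> topspace (cube k)" if "z \<in> topspace (cube (Suc k))" for z
    using that unfolding topspace_cube rst_def by (auto simp: PiE_iff)
  \<comment> \<open>Time is stretched too: near the two time faces \<open>F\<close> does not depend
    on time and equals \<open>g\<close> or \<open>h\<close> after stretching, which are
    \<open>T\<close>-continuous.\<close>
  define F where "F z = H (stretch (Suc k) 1 z k, stretch k 1 (rst z))" for z
  have rst_cont: "continuous_map (cube (Suc k)) (cube k) rst"
  proof (rule continuous_map_into_cube)
    show "continuous_map (cube (Suc k)) euclideanreal (\<lambda>z. rst z i)" if "i < k" for i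
      using continuous_map_cube_coordinate[of i "Suc k"] that by (simp add: rst_def)
  qed (rule rst)
  have "continuous_map (cube (Suc k)) unit_interval (\<lambda>z. z k)"
    unfolding cube_def by (intro continuous_map_product_projection) simp
  from continuous_map_compose[OF continuous_map_stretch_1 this]
  have "continuous_map (cube (Suc k)) (prod_topology unit_interval (cube k))
      (\<lambda>z. (stretch (Suc k) 1 z k, stretch k 1 (rst z)))"
    using continuous_map_compose[OF rst_cont continuous_map_stretch_1]
    by (simp add: continuous_map_pairwise o_def)
  from continuous_map_compose[OF this H(1)] have F: "continuous_map (cube (Suc k)) M F"
    by (rule continuous_map_eq) (simp add: F_def)
  have sq01: "stretch (Suc k) 1 z k \<in> {0..1}" if "z \<in> topspace (cube (Suc k))" for z
    using cube_coordinate_bounds[OF stretch_in_cube[OF that], of 1 k] by simp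
  have "continuous_map (subtopology (cube (Suc k)) (collar (Suc k))) T F"
  proof -
    \<comment> \<open>The collar of the larger cube consists of bottom, top and sides; there
      \<open>F\<close> is given by \<open>g\<close>, by \<open>h\<close> and by the constant
      \<open>p\<close>.\<close>
    define A where "A = {z \<in> topspace (cube (Suc k)). z k \<le> 1/4}"
    define B where "B = {z \<in> topspace (cube (Suc k)). 3/4 \<le> z k}"
    define S where "S = {z \<in> topspace (cube (Suc k)). \<exists>i<k. z i \<le> 1/4 \<or> 3/4 \<le> z i}"
    have cl: "closedin (cube (Suc k)) A" "closedin (cube (Suc k)) B" "closedin (cube (Suc k)) S"
      unfolding A_def B_def S_def
      by (rule closedin_cube_le(1), simp) (rule closedin_cube_le(2), simp, rule closedin_cube_sides, simp)
    have sq_cont: "continuous_map (subtopology (cube (Suc k)) D) T (\<lambda>z. u (stretch k 1 (rst z)))"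
      if "u \<in> cube_maps k T p" for u D
    proof -
      have "continuous_map (cube k) T u"
        using that by (simp add: cube_maps_def)
      from continuous_map_compose[OF rst_cont continuous_map_compose[OF continuous_map_stretch_1 this]]
      show ?thesis
        by (intro continuous_map_from_subtopology) (simp add: o_def)
    qed
    have fA: "continuous_map (subtopology (cube (Suc k)) A) T F"
    proof (rule continuous_map_eq[OF sq_cont[OF g]])
      fix z assume "z \<in> topspace (subtopology (cube (Suc k)) A)"
      then have "stretch (Suc k) 1 z k = 0"
        by (simp add: A_def stretch_def)
      then show "g (stretch k 1 (rst z)) = F z"
        by (simp only: F_def H(2)[rule_format])
    qed
    have fB: "continuous_map (subtopology (cube (Suc k)) B) T F"
    proof (rule continuous_map_eq[OF sq_cont[OF h]])
      fix z assume "z \<in> topspace (subtopology (cube (Suc k)) B)"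
      then have "stretch (Suc k) 1 z k = 1"
        by (simp add: B_def stretch_def)
      then show "h (stretch k 1 (rst z)) = F z"
        by (simp only: F_def H(3)[rule_format])
    qed
    have Fp: "F z = p" if zS: "z \<in> S" for z
    proof -
      have z: "z \<in> topspace (cube (Suc k))"
        using zS by (simp add: S_def)
      obtain i where i: "i < k" "z i \<le> 1/4 \<or> 3/4 \<le> z i"
        using zS unfolding S_def by blast
      have "rst z i = z i"
        using i(1) by (simp add: rst_def)
      then have "rst z \<in> collar k"
        using i rst[OF z] unfolding collar_def by auto
      then show ?thesis
        unfolding F_def using sq01[OF z] by (intro Hp stretch_collar)
    qed
    have fS: "continuous_map (subtopology (cube (Suc k)) S) T F"
      by (rule continuous_map_eq[where f = "\<lambda>x. p"]) (use p Fp in simp_all)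
    have "collar (Suc k) = A \<union> B \<union> S"
      unfolding collar_def A_def B_def S_def Ex_less_Suc by blast
    then show ?thesis
      using continuous_map_subtopology_Un[OF closedin_Un[OF cl(1,2)] cl(3)
          continuous_map_subtopology_Un[OF cl(1,2) fA fB] fS] by simp
  qed
  from deform_cube[OF lc F this] obtain G
    where G: "homotopic_with (\<lambda>u. \<forall>z\<in>cube_boundary (Suc k). u z = F z) (cube (Suc k)) M F G"
      "continuous_map (cube (Suc k)) T G"
    by (elim exE conjE)
  have GF: "G z = F z" if "z \<in> cube_boundary (Suc k)" for z
    using homotopic_with_imp_property[OF G(1)] that by blast
  \<comment> \<open>\<open>ins\<close> puts time back as coordinate \<open>k\<close>, which
    \<open>rst\<close> had dropped.\<close>
  define ins where "ins s x = (\<lambda>i. if i = k then s else x i)" for s :: real and x :: "nat \<Rightarrow> real"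
  have ins: "ins s x \<in> topspace (cube (Suc k))" if "s \<in> {0..1}" "x \<in> topspace (cube k)" for s x
    unfolding topspace_cube
  proof (rule PiE_I)
    show "ins s x i \<in> {0..1}" if "i \<in> {..<Suc k}" for i
      using cube_coordinate_bounds[OF \<open>x \<in> topspace (cube k)\<close>, of i] \<open>s \<in> {0..1}\<close> that
      by (cases "i = k") (simp_all add: ins_def)
    show "ins s x i = undefined" if "i \<notin> {..<Suc k}" for i
      using PiE_arb[of x "{..<k}" "\<lambda>_. {0..1}" i] \<open>x \<in> topspace (cube k)\<close> that
      by (simp add: ins_def topspace_cube)
  qed
  have rins: "rst (ins s x) = x" if "x \<in> topspace (cube k)" for s x
  proof
    show "rst (ins s x) i = x i" for i
      using PiE_arb[of x "{..<k}" "\<lambda>_. {0..1}" i] that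
      by (cases "i < k") (simp_all add: rst_def ins_def topspace_cube)
  qed
  have ins_cont: "continuous_map (prod_topology unit_interval (cube k)) (cube (Suc k)) (\<lambda>(s, x). ins s x)"
  proof (rule continuous_map_into_cube)
    let ?X = "prod_topology unit_interval (cube k)"
    fix i assume i: "i < Suc k"
    show "continuous_map ?X euclideanreal (\<lambda>z. (case z of (s, x) \<Rightarrow> ins s x) i)"
    proof (cases "i = k")
      case True
      then show ?thesis
        using continuous_map_unit_intervalD[OF continuous_map_fst, of "cube k"]
        by (simp add: ins_def case_prod_beta)
    next
      case False
      then have "continuous_map (cube k) euclideanreal (\<lambda>x. x i)"
        using i by (intro continuous_map_cube_coordinate) simp
      from continuous_map_compose[OF continuous_map_snd this] False show ?thesis
        by (simp add: ins_def case_prod_beta o_def)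
    qed
  qed (auto intro: ins)
  define K where "K = G \<circ> (\<lambda>(s, x). ins s x)"
  have K: "continuous_map (prod_topology unit_interval (cube k)) T K"
    unfolding K_def by (rule continuous_map_compose[OF ins_cont G(2)])
  have insbd: "ins s x \<in> cube_boundary (Suc k)"
    if "s \<in> {0..1}" "x \<in> topspace (cube k)" "s = 0 \<or> s = 1 \<or> x \<in> cube_boundary k" for s x
  proof (cases "s = 0 \<or> s = 1")
    case True
    then show ?thesis
      using ins[OF that(1,2)] unfolding cube_boundary_def by (auto simp: ins_def)
  next
    case False
    then obtain i where "i < k" "x i = 0 \<or> x i = 1"
      using \<open>s = 0 \<or> s = 1 \<or> x \<in> cube_boundary k\<close> by (auto simp: cube_boundary_def)
    then have "i < Suc k" "ins s x i = 0 \<or> ins s x i = 1"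
      by (simp_all add: ins_def)
    then show ?thesis
      using ins[OF that(1,2)] unfolding cube_boundary_def by blast
  qed
  have bd: "cube_boundary k \<subseteq> topspace (cube k)"
    by (auto simp: cube_boundary_def)
  \<comment> \<open>The time faces belong to the boundary, where \<open>G\<close> still agrees with
    \<open>F\<close>; hence \<open>K\<close> starts at the stretched \<open>g\<close>.\<close>
  have K0: "K (0, x) = g (stretch k 1 x)" if "x \<in> topspace (cube k)" for x
  proof -
    have "K (0, x) = F (ins 0 x)"
      using GF[OF insbd[of 0 x]] that by (simp add: K_def)
    moreover have "stretch (Suc k) 1 (ins 0 x) k = 0"
      by (simp add: ins_def stretch_def)
    ultimately show ?thesis
      using H(2) by (simp add: F_def rins[OF that])
  qed
  have K1: "K (1, x) = h (stretch k 1 x)" if "x \<in> topspace (cube k)" for x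
  proof -
    have "K (1, x) = F (ins 1 x)"
      using GF[OF insbd[of 1 x]] that by (simp add: K_def)
    moreover have "stretch (Suc k) 1 (ins 1 x) k = 1"
      by (simp add: ins_def stretch_def)
    ultimately show ?thesis
      using H(3) by (simp add: F_def rins[OF that])
  qed
  have Kp: "K (t, x) = p" if "t \<in> {0..1}" "x \<in> cube_boundary k" for t x
  proof -
    have x: "x \<in> topspace (cube k)"
      using that(2) bd by blast
    have "K (t, x) = H (stretch (Suc k) 1 (ins t x) k, stretch k 1 x)"
      using GF[OF insbd[OF that(1) x]] that(2) by (simp add: K_def F_def rins[OF x])
    also have "\<dots> = p"
      using that(2) by (intro Hp sq01 ins[OF that(1) x] stretch_boundary) simp_all
    finally show ?thesis .
  qed
  have "homotopic_with (\<lambda>u. u ` cube_boundary k \<subseteq> {p}) (cube k) T (g \<circ> stretch k 1) (h \<circ> stretch k 1)"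
  proof (subst homotopic_with)
    show "(u ` cube_boundary k \<subseteq> {p}) = (v ` cube_boundary k \<subseteq> {p})"
      if "\<And>x. x \<in> topspace (cube k) \<Longrightarrow> u x = v x" for u v :: "(nat \<Rightarrow> real) \<Rightarrow> 'a"
      using that bd by (simp add: image_subset_iff subset_iff)
    show "\<exists>h'. continuous_map (prod_topology unit_interval (cube k)) T h' \<and>
        (\<forall>x\<in>topspace (cube k). h' (0, x) = (g \<circ> stretch k 1) x) \<and>
        (\<forall>x\<in>topspace (cube k). h' (1, x) = (h \<circ> stretch k 1) x) \<and>
        (\<forall>t\<in>{0..1}. (\<lambda>x. h' (t, x)) ` cube_boundary k \<subseteq> {p})"
      using K K0 K1 Kp by (intro exI[of _ K]) auto
  qed
  then have "(g \<circ> stretch k 1, h \<circ> stretch k 1) \<in> cube_homotopy k T p"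
    by (simp add: cube_homotopy_def)
  moreover have "sym (cube_homotopy k T p)" "trans (cube_homotopy k T p)"
    using equiv_cube_homotopy[of k T p] by (simp_all add: equiv_def)
  ultimately show ?thesis
    using stretch_homotopy[OF g] stretch_homotopy[OF h] by (blast dest: symD transD)
qed

text \<open>The induced map sends the class of \<open>g\<close> for \<open>T\<close> to the class of
  the same \<open>g\<close> for \<open>M\<close>, so bijectivity reduces to the two lifting
  lemmas.\<close>

theorem locally_contracting_imp_weak_homotopy_equivalence:
  assumes inc: "continuous_map T M id" and lc: "locally_contracting T M"
  shows "weak_homotopy_equivalence T M id"
  unfolding weak_homotopy_equivalence_def
proof (intro conjI allI ballI inc)
  fix k p assume p: "p \<in> topspace T"
  have ind: "homotopy_induced k M p id (cube_homotopy k T p `` {g}) = cube_homotopy k M p `` {g}"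
    if "g \<in> cube_maps k T p" for g
    using homotopy_induced_class[OF inc that] by simp
  have "inj_on (homotopy_induced k M p id) (homotopy_set k T p)"
  proof (rule inj_onI)
    fix C D
    assume "C \<in> homotopy_set k T p" "D \<in> homotopy_set k T p"
      and eq: "homotopy_induced k M p id C = homotopy_induced k M p id D"
    then obtain g h where gh: "g \<in> cube_maps k T p" "C = cube_homotopy k T p `` {g}"
        "h \<in> cube_maps k T p" "D = cube_homotopy k T p `` {h}"
      unfolding homotopy_set_def by (elim quotientE) blast
    have "cube_homotopy k M p `` {g} = cube_homotopy k M p `` {h}"
      using eq gh ind by simp
    then have "(g, h) \<in> cube_homotopy k M p"
      by (rule eq_equiv_class[OF _ equiv_cube_homotopy cube_maps_mono[OF inc gh(3)]])
    then have "(g, h) \<in> cube_homotopy k T p"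
      by (rule homotopy_lifts_inj[OF lc p gh(1,3)])
    then show "C = D"
      unfolding gh(2,4) by (rule equiv_class_eq[OF equiv_cube_homotopy])
  qed
  moreover have "homotopy_induced k M p id ` homotopy_set k T p = homotopy_set k M p"
  proof (intro equalityI subsetI)
    fix D assume "D \<in> homotopy_induced k M p id ` homotopy_set k T p"
    then obtain g where "g \<in> cube_maps k T p" "D = cube_homotopy k M p `` {g}"
      unfolding homotopy_set_def using ind by (auto elim!: quotientE)
    then show "D \<in> homotopy_set k M p"
      unfolding homotopy_set_def using cube_maps_mono[OF inc] by (auto intro: quotientI)
  next
    fix D assume "D \<in> homotopy_set k M p"
    then obtain f where f: "f \<in> cube_maps k M p" "D = cube_homotopy k M p `` {f}"
      unfolding homotopy_set_def by (elim quotientE) blast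
    obtain g where g: "g \<in> cube_maps k T p" "(f, g) \<in> cube_homotopy k M p"
      using homotopy_lifts_surj[OF lc p f(1)] by blast
    have "D = homotopy_induced k M p id (cube_homotopy k T p `` {g})"
      unfolding f(2) ind[OF g(1)] by (rule equiv_class_eq[OF equiv_cube_homotopy g(2)])
    moreover have "cube_homotopy k T p `` {g} \<in> homotopy_set k T p"
      unfolding homotopy_set_def using g(1) by (rule quotientI)
    ultimately show "D \<in> homotopy_induced k M p id ` homotopy_set k T p"
      by blast
  qed
  ultimately show "bij_betw (homotopy_induced k M (id p) id) (homotopy_set k T p) (homotopy_set k M (id p))"
    by (simp add: bij_betw_def)
qed

section \<open>Contractions in well-filled charts\<close>

lemma tvs_continuous_map_segment:
  assumes E: "topological_vector_space E"
    and a: "continuous_map X euclideanreal a"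
    and u: "continuous_map X E u" and w: "continuous_map X E w"
  shows "continuous_map X E (\<lambda>x. (1 - a x) *\<^sub>R u x + a x *\<^sub>R w x)"
proof -
  have add: "continuous_map (prod_topology E E) E (\<lambda>(x, y). x + y)"
    and scale: "continuous_map (prod_topology euclideanreal E) E (\<lambda>(t, x). t *\<^sub>R x)"
    using E by (simp_all add: topological_vector_space_def)
  have sc: "continuous_map X E (\<lambda>x. b x *\<^sub>R v x)"
    if "continuous_map X euclideanreal b" "continuous_map X E v" for b v
  proof -
    have "continuous_map X (prod_topology euclideanreal E) (\<lambda>x. (b x, v x))"
      using that by (simp add: continuous_map_pairwise o_def)
    from continuous_map_compose[OF this scale] show ?thesis
      by (simp add: o_def)
  qed
  have "continuous_map X euclideanreal (\<lambda>x. 1 - a x)"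
    using a by (intro continuous_map_diff) simp_all
  then have "continuous_map X (prod_topology E E) (\<lambda>x. ((1 - a x) *\<^sub>R u x, a x *\<^sub>R w x))"
    using sc a u w by (simp add: continuous_map_pairwise o_def)
  from continuous_map_compose[OF this add] show ?thesis
    by (simp add: o_def)
qed

lemma directed_index_upper_bound:
  assumes dir: "directed_index A le" and "finite B" and "B \<subseteq> A"
  shows "\<exists>u\<in>A. \<forall>b\<in>B. le b u"
  using assms(2,3)
proof (induction B)
  case empty
  then show ?case
    using dir by (auto simp: directed_index_def)
next
  case (insert b B)
  then obtain u where u: "u \<in> A" "\<forall>b\<in>B. le b u"
    by auto
  obtain v where v: "v \<in> A" "le b v" "le u v"
    using dir u(1) insert.prems unfolding directed_index_def by blast
  have "le c v" if "c \<in> B" for c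
    using dir u v that insert.prems unfolding directed_index_def transp_on_def by blast
  then show ?case
    using v by (intro bexI[of _ v]) auto
qed

text \<open>Compact retractivity puts \<open>K\<close> and \<open>y\<close>, with the right
  topology, into one \<open>Ms \<alpha>\<close>; compactness and directedness put them into one
  chart domain \<open>Us \<beta>\<close>; condition (f) puts all segments into one
  \<open>Vs \<gamma>\<close>. There segments are continuous in \<open>Es \<gamma>\<close>, and the
  inverse chart leads back to \<open>Ms \<gamma>\<close>, which maps continuously to
  \<open>T\<close>.\<close>

lemma chart_segment_continuous:
  assumes dir: "directed_family A le (\<lambda>\<alpha>. topspace (Ms \<alpha>))"
    and MM: "\<And>\<alpha> \<beta>. \<alpha> \<in> A \<Longrightarrow> \<beta> \<in> A \<Longrightarrow> le \<alpha> \<beta> \<Longrightarrow> continuous_map (Ms \<alpha>) (Ms \<beta>) id"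
    and MT: "\<And>\<alpha>. \<alpha> \<in> A \<Longrightarrow> continuous_map (Ms \<alpha>) T id"
    and retr: "compactly_retractive T A Ms"
    and chart: "well_filled_chart A le M Ms E U V \<phi> \<alpha>0 Es Us Vs \<phi>s V2"
    and inv: "\<And>x. x \<in> U \<Longrightarrow> \<psi> (\<phi> x) = x"
    and K: "compactin T K" "K \<subseteq> {x \<in> U. \<phi> x \<in> V2}"
    and y: "y \<in> topspace T" "y \<in> U" "\<phi> y \<in> V2"
  shows "continuous_map (prod_topology unit_interval (subtopology T K)) T
           (\<lambda>(t, p). \<psi> ((1 - t) *\<^sub>R \<phi> p + t *\<^sub>R \<phi> y))"
proof -
  define A0 where "A0 = {\<alpha> \<in> A. le \<alpha>0 \<alpha>}"
  note wf = chart[unfolded well_filled_chart_def Let_def, folded A0_def]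
  have \<alpha>0: "\<alpha>0 \<in> A"
    and Es: "\<forall>\<alpha>\<in>A0. topological_vector_space (Es \<alpha>) \<and> continuous_map (Es \<alpha>) E id \<and>
           openin (Ms \<alpha>) (Us \<alpha>) \<and> Vs \<alpha> \<subseteq> topspace (Es \<alpha>) \<and>
           homeomorphic_map (subtopology (Ms \<alpha>) (Us \<alpha>)) (subtopology (Es \<alpha>) (Vs \<alpha>)) (\<phi>s \<alpha>)"
    and EE: "\<forall>\<alpha>\<in>A0. \<forall>\<beta>\<in>A0. le \<alpha> \<beta> \<longrightarrow> continuous_map (Es \<alpha>) (Es \<beta>) id"
    and UsU: "\<forall>\<alpha>\<in>A0. Us \<alpha> \<subseteq> U \<and> (\<forall>x\<in>Us \<alpha>. \<phi> x = \<phi>s \<alpha> x)"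
    and UsUs: "\<forall>\<alpha>\<in>A0. \<forall>\<beta>\<in>A0. le \<alpha> \<beta> \<longrightarrow> Us \<alpha> \<subseteq> Us \<beta> \<and> (\<forall>x\<in>Us \<alpha>. \<phi>s \<beta> x = \<phi>s \<alpha> x)"
    and UnUs: "(\<Union>\<alpha>\<in>A0. Us \<alpha>) = U \<inter> (\<Union>\<alpha>\<in>A. topspace (Ms \<alpha>))"
    and filled: "\<forall>\<alpha>\<in>A0. \<forall>K. K \<subseteq> V2 \<inter> Vs \<alpha> \<and> compactin (Es \<alpha>) K \<longrightarrow>
           (\<exists>\<beta>\<in>A0. le \<alpha> \<beta> \<and> conv2 K \<subseteq> Vs \<beta>)"
    using wf by - (elim conjE, assumption)+
  have dirA: "directed_index A le"
    using dir by (simp add: directed_family_def)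
  have trans: "le a c" if "le a b" "le b c" "a \<in> A" "b \<in> A" "c \<in> A" for a b c
    using dirA that unfolding directed_index_def transp_on_def by blast
  have ub: "\<exists>c\<in>A. le a c \<and> le b c" if "a \<in> A" "b \<in> A" for a b
    using dirA that unfolding directed_index_def by blast
  \<comment> \<open>Condition (f) speaks of segments within a single compact set, so the end point
    \<open>y\<close> is adjoined to \<open>K\<close>.\<close>
  define L where "L = insert y K"
  have LU: "L \<subseteq> U" and LV2: "\<phi> ` L \<subseteq> V2"
    using K(2) y by (auto simp: L_def)
  have L: "compactin T L"
    using compactin_Un[OF finite_imp_compactin[of "{y}" T] K(1)] y(1) by (simp add: L_def)
  obtain \<alpha> where \<alpha>: "\<alpha> \<in> A" "L \<subseteq> topspace (Ms \<alpha>)" "subtopology (Ms \<alpha>) L = subtopology T L"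
    using retr L unfolding compactly_retractive_def by blast
  have L\<alpha>: "compactin (Ms \<alpha>) L"
    using L \<alpha> by (simp add: compactin_subspace)
  obtain \<gamma>1 where \<gamma>1: "\<gamma>1 \<in> A" "le \<alpha> \<gamma>1" "le \<alpha>0 \<gamma>1"
    using ub[OF \<alpha>(1) \<alpha>0] by blast
  have up: "\<beta> \<in> A0 \<and> le \<alpha> \<beta>" if "\<beta> \<in> A" "le \<gamma>1 \<beta>" for \<beta>
    using trans[OF \<gamma>1(2) that(2) \<alpha>(1) \<gamma>1(1) that(1)] trans[OF \<gamma>1(3) that(2) \<alpha>0 \<gamma>1(1) that(1)] that
    by (simp add: A0_def)
  define B where "B = {\<beta> \<in> A. le \<gamma>1 \<beta>}"
  \<comment> \<open>Traces of the chart domains on \<open>Ms \<alpha>\<close>. Indices in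
    \<open>B\<close> lie above \<alpha>, which makes the traces open, and above \<alpha>0, where the
    charts exist. The domains grow with the index, so a finite subcover of \<open>L\<close> is
    absorbed by a single one.\<close>
  define D where "D \<beta> = {x \<in> topspace (Ms \<alpha>). x \<in> Us \<beta>}" for \<beta>
  have op: "openin (Ms \<alpha>) (D \<beta>)" if "\<beta> \<in> B" for \<beta>
  proof -
    have \<beta>: "\<beta> \<in> A0" "le \<alpha> \<beta>" "\<beta> \<in> A"
      using up that by (auto simp: B_def)
    have "openin (Ms \<beta>) (Us \<beta>)"
      using bspec[OF Es \<beta>(1)] by blast
    then show ?thesis
      using openin_continuous_map_preimage[OF MM[OF \<alpha>(1) \<beta>(3,2)]] by (simp add: D_def)
  qed
  have cov: "L \<subseteq> \<Union>(D ` B)"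
  proof
    fix x assume x: "x \<in> L"
    then have "x \<in> U" "x \<in> (\<Union>\<alpha>\<in>A. topspace (Ms \<alpha>))"
      using LU \<alpha>(1,2) by auto
    then have "x \<in> (\<Union>\<alpha>\<in>A0. Us \<alpha>)"
      unfolding UnUs by (rule IntI)
    then obtain \<beta>0 where \<beta>0: "\<beta>0 \<in> A0" "x \<in> Us \<beta>0"
      by blast
    then have "\<beta>0 \<in> A"
      by (simp add: A0_def)
    then obtain \<beta> where \<beta>: "\<beta> \<in> A" "le \<beta>0 \<beta>" "le \<gamma>1 \<beta>"
      using ub[OF _ \<gamma>1(1)] by blast
    then have "x \<in> Us \<beta>"
      using UsUs \<beta>0 up by blast
    then show "x \<in> \<Union>(D ` B)"
      using \<beta> x \<alpha>(2) by (auto simp: D_def B_def)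
  qed
  obtain \<F> where \<F>: "finite \<F>" "\<F> \<subseteq> D ` B" "L \<subseteq> \<Union>\<F>"
    using compactinD[OF L\<alpha>, of "D ` B"] op cov by blast
  obtain B' where B': "B' \<subseteq> B" "finite B'" "\<F> = D ` B'"
    using finite_subset_image[OF \<F>(1,2)] by blast
  obtain \<beta> where \<beta>: "\<beta> \<in> A" "\<forall>b\<in>insert \<gamma>1 B'. le b \<beta>"
    using directed_index_upper_bound[OF dirA, of "insert \<gamma>1 B'"] B' \<gamma>1(1) by (auto simp: B_def)
  have \<beta>0: "\<beta> \<in> A0" "le \<alpha> \<beta>"
    using up \<beta> by auto
  have L\<beta>: "L \<subseteq> Us \<beta>"
  proof
    fix x assume "x \<in> L"
    then obtain b where b: "b \<in> B'" "x \<in> Us b"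
      using \<F>(3) B'(3) by (auto simp: D_def)
    then have "b \<in> A0" "le b \<beta>"
      using up B'(1) \<beta>(2) by (auto simp: B_def)
    then show "x \<in> Us \<beta>"
      using UsUs \<beta>0(1) b(2) by blast
  qed
  have \<phi>\<beta>: "\<phi> x = \<phi>s \<beta> x" if "x \<in> Us \<beta>" for x
    using UsU \<beta>0(1) that by blast
  have hom\<beta>: "homeomorphic_map (subtopology (Ms \<beta>) (Us \<beta>)) (subtopology (Es \<beta>) (Vs \<beta>)) (\<phi>s \<beta>)"
    using Es \<beta>0(1) by blast
  have cont\<beta>: "continuous_map (subtopology (Ms \<beta>) (Us \<beta>)) (subtopology (Es \<beta>) (Vs \<beta>)) (\<phi>s \<beta>)"
    using hom\<beta> by (rule homeomorphic_imp_continuous_map)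
  have "compactin (Ms \<beta>) L"
    using image_compactin[OF L\<alpha> MM[OF \<alpha>(1) \<beta>(1) \<beta>0(2)]] by simp
  then have "compactin (subtopology (Ms \<beta>) (Us \<beta>)) L"
    using L\<beta> by (simp add: compactin_subtopology)
  from image_compactin[OF this cont\<beta>] have "compactin (Es \<beta>) (\<phi>s \<beta> ` L)" "\<phi>s \<beta> ` L \<subseteq> Vs \<beta>"
    by (simp_all add: compactin_subtopology)
  moreover have \<phi>L: "\<phi>s \<beta> ` L = \<phi> ` L"
    using \<phi>\<beta> L\<beta> by (intro image_cong) auto
  ultimately obtain \<gamma> where \<gamma>: "\<gamma> \<in> A0" "le \<beta> \<gamma>" "conv2 (\<phi> ` L) \<subseteq> Vs \<gamma>"
    using filled \<beta>0(1) LV2 by (metis le_inf_iff)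
  have \<gamma>A: "\<gamma> \<in> A"
    using \<gamma>(1) by (simp add: A0_def)
  have hom\<gamma>: "homeomorphic_map (subtopology (Ms \<gamma>) (Us \<gamma>)) (subtopology (Es \<gamma>) (Vs \<gamma>)) (\<phi>s \<gamma>)"
    and tvs\<gamma>: "topological_vector_space (Es \<gamma>)" and Vs\<gamma>: "Vs \<gamma> \<subseteq> topspace (Es \<gamma>)"
    using Es \<gamma>(1) by blast+
  obtain \<theta> where \<theta>: "homeomorphic_maps (subtopology (Ms \<gamma>) (Us \<gamma>)) (subtopology (Es \<gamma>) (Vs \<gamma>)) (\<phi>s \<gamma>) \<theta>"
    using hom\<gamma> unfolding homeomorphic_map_maps by (elim exE)
  have \<theta>_cont: "continuous_map (subtopology (Es \<gamma>) (Vs \<gamma>)) (subtopology (Ms \<gamma>) (Us \<gamma>)) \<theta>"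
    and \<theta>_inv: "\<And>v. v \<in> Vs \<gamma> \<Longrightarrow> \<phi>s \<gamma> (\<theta> v) = v"
    using \<theta> Vs\<gamma> by (auto simp: homeomorphic_maps_def)
  \<comment> \<open>The inverse of \<open>\<phi>s \<gamma>\<close> is the restriction of \<psi>; so
    continuity into \<open>Ms \<gamma>\<close> passes from \<theta> to \<psi>.\<close>
  have \<theta>\<psi>: "\<theta> v = \<psi> v" if v: "v \<in> Vs \<gamma>" for v
  proof -
    have "v \<in> topspace (subtopology (Es \<gamma>) (Vs \<gamma>))"
      using v Vs\<gamma> by auto
    then have "\<theta> v \<in> topspace (subtopology (Ms \<gamma>) (Us \<gamma>))"
      using \<theta>_cont unfolding continuous_map_def Pi_iff by blast
    then have "\<theta> v \<in> Us \<gamma>"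
      by simp
    then have "\<theta> v \<in> U" "\<phi> (\<theta> v) = v"
      using UsU \<gamma>(1) \<theta>_inv[OF v] by auto
    then show ?thesis
      using inv[of "\<theta> v"] by simp
  qed
  let ?X = "prod_topology unit_interval (subtopology T K)"
  have KL: "K \<subseteq> L"
    by (auto simp: L_def)
  have "continuous_map ?X (subtopology T L) snd"
    using continuous_map_snd[of unit_interval "subtopology T K"] KL
    by (auto simp: continuous_map_in_subtopology)
  \<comment> \<open>On \<open>L\<close> the topologies of \<open>T\<close> and
    \<open>Ms \<alpha>\<close> coincide; this is what allows the passage from \<open>T\<close> back
    to a step of the family.\<close>
  then have "continuous_map ?X (Ms \<alpha>) snd"
    using \<alpha>(3) by (metis continuous_map_in_subtopology)
  from continuous_map_compose[OF this MM[OF \<alpha>(1) \<beta>(1) \<beta>0(2)]]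
  have "continuous_map ?X (subtopology (Ms \<beta>) (Us \<beta>)) snd"
    using KL L\<beta> by (intro continuous_map_into_subtopology) auto
  from continuous_map_compose[OF this cont\<beta>]
  have "continuous_map ?X (Es \<beta>) (\<phi>s \<beta> \<circ> snd)"
    by (simp add: continuous_map_in_subtopology)
  from continuous_map_compose[OF this EE[rule_format, OF \<beta>0(1) \<gamma>(1,2)]]
  have \<phi>_cont: "continuous_map ?X (Es \<gamma>) (\<lambda>z. \<phi> (snd z))"
    by (rule continuous_map_eq) (use \<phi>\<beta> KL L\<beta> in auto)
  have conv: "(1 - t) *\<^sub>R \<phi> p + t *\<^sub>R \<phi> y \<in> Vs \<gamma>" if "t \<in> {0..1}" "p \<in> K" for t p
  proof -
    have "t *\<^sub>R \<phi> y + (1 - t) *\<^sub>R \<phi> p \<in> conv2 (\<phi> ` L)"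
      using that unfolding conv2_def L_def by blast
    then show ?thesis
      using \<gamma>(3) by (auto simp: add.commute)
  qed
  have "\<phi> y \<in> conv2 (\<phi> ` L)"
    unfolding conv2_def
    by (rule CollectI, rule exI[of _ 1], rule exI[of _ "\<phi> y"], rule exI[of _ "\<phi> y"])
      (simp add: L_def)
  then have "\<phi> y \<in> topspace (Es \<gamma>)"
    using \<gamma>(3) Vs\<gamma> by blast
  then have "continuous_map ?X (Es \<gamma>) (\<lambda>z. (1 - fst z) *\<^sub>R \<phi> (snd z) + fst z *\<^sub>R \<phi> y)"
    using continuous_map_unit_intervalD[OF continuous_map_fst] \<phi>_cont
    by (intro tvs_continuous_map_segment[OF tvs\<gamma>]) simp_all
  then have "continuous_map ?X (subtopology (Es \<gamma>) (Vs \<gamma>)) (\<lambda>z. (1 - fst z) *\<^sub>R \<phi> (snd z) + fst z *\<^sub>R \<phi> y)"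
    using conv by (intro continuous_map_into_subtopology) auto
  from continuous_map_compose[OF this \<theta>_cont]
  have "continuous_map ?X (Ms \<gamma>) (\<theta> \<circ> (\<lambda>z. (1 - fst z) *\<^sub>R \<phi> (snd z) + fst z *\<^sub>R \<phi> y))"
    by (simp add: continuous_map_in_subtopology)
  from continuous_map_compose[OF this MT[OF \<gamma>A]] show ?thesis
    by (rule continuous_map_eq) (use conv \<theta>\<psi> in auto)
qed

lemma conv2I:
  "a \<in> Y \<Longrightarrow> b \<in> Y \<Longrightarrow> t \<in> {0..1} \<Longrightarrow> (1 - t) *\<^sub>R a + t *\<^sub>R b \<in> conv2 Y"
  unfolding conv2_def by (rule CollectI, rule exI[of _ t]) (auto simp: add.commute)

text \<open>The constant segment at \<open>\<phi> q\<close> stays in the preimage of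
  \<open>W\<close> under \<psi>. By compactness of the unit interval so do all segments between
  points of a small neighbourhood \<open>G\<close>, although \<open>G\<close> need not be convex;
  this takes the place of local convexity. The contraction runs along segments towards
  \<open>\<phi> y\<close> for a point \<open>y\<close> of \<open>T\<close>.\<close>

lemma well_filled_charts_imp_locally_contracting:
  fixes Ms :: "'i \<Rightarrow> 'a topology"
  assumes dir: "directed_family A le (\<lambda>\<alpha>. topspace (Ms \<alpha>))"
    and dense: "M closure_of (\<Union>\<alpha>\<in>A. topspace (Ms \<alpha>)) = topspace M"
    and MM: "\<And>\<alpha> \<beta>. \<alpha> \<in> A \<Longrightarrow> \<beta> \<in> A \<Longrightarrow> le \<alpha> \<beta> \<Longrightarrow> continuous_map (Ms \<alpha>) (Ms \<beta>) id"
    and charts: "admits_well_filled_charts TYPE('e::real_vector) A le M Ms"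
    and topT: "topspace T = (\<Union>\<alpha>\<in>A. topspace (Ms \<alpha>))"
    and MT: "\<And>\<alpha>. \<alpha> \<in> A \<Longrightarrow> continuous_map (Ms \<alpha>) T id"
    and retr: "compactly_retractive T A Ms"
  shows "locally_contracting T M"
  unfolding locally_contracting_def
proof (intro allI impI, elim conjE)
  fix q W assume W: "openin M W" "q \<in> W"
  then have "q \<in> topspace M"
    using openin_subset by blast
  then obtain C where "core_of_well_filled_chart TYPE('e) A le M Ms C" "q \<in> C"
    using charts unfolding admits_well_filled_charts_def by blast
  then obtain E :: "'e topology" and U V \<phi> \<alpha>0 Es Us Vs \<phi>s V2
    where chart: "well_filled_chart A le M Ms E U V \<phi> \<alpha>0 Es Us Vs \<phi>s V2" and q: "q \<in> U" "\<phi> q \<in> V2"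
    unfolding core_of_well_filled_chart_def by blast
  have E: "topological_vector_space E" and U: "openin M U" and V: "V \<subseteq> topspace E"
    and hom: "homeomorphic_map (subtopology M U) (subtopology E V) \<phi>"
    and V2: "openin (subtopology E V) V2" "conv2 V2 \<subseteq> V"
    using chart[unfolded well_filled_chart_def Let_def] by - (elim conjE, assumption)+
  have UM: "U \<subseteq> topspace M"
    using U by (rule openin_subset)
  have V2V: "V2 \<subseteq> V"
    using openin_subset[OF V2(1)] by simp
  obtain \<psi> where \<psi>: "homeomorphic_maps (subtopology M U) (subtopology E V) \<phi> \<psi>"
    using hom unfolding homeomorphic_map_maps by (elim exE)
  have \<phi>_cont: "continuous_map (subtopology M U) (subtopology E V) \<phi>"
    and \<psi>_cont: "continuous_map (subtopology E V) (subtopology M U) \<psi>"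
    and inv: "\<And>x. x \<in> U \<Longrightarrow> \<psi> (\<phi> x) = x"
    using \<psi> UM by (auto simp: homeomorphic_maps_def)
  have \<psi>M: "continuous_map (subtopology E V) M \<psi>"
    using \<psi>_cont by (simp add: continuous_map_in_subtopology)
  \<comment> \<open>Segments between points of \<open>V2\<close> stay in \<open>V\<close>, so \<psi>
    can be applied along them.\<close>
  define E2 where "E2 = subtopology (subtopology E V) V2"
  have topE2: "topspace E2 = V2"
    using V V2V by (auto simp: E2_def)
  define X where "X = prod_topology unit_interval (prod_topology E2 E2)"
  define F where "F = (\<lambda>z. (1 - fst z) *\<^sub>R fst (snd z) + fst z *\<^sub>R (snd (snd z) :: 'e))"
  have E2E: "continuous_map E2 E id"
    by (simp add: E2_def subtopology_subtopology continuous_map_from_subtopology)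
  have F: "continuous_map X (subtopology E V) F"
  proof (rule continuous_map_into_subtopology)
    have "continuous_map X (prod_topology E2 E2) snd"
      unfolding X_def by (rule continuous_map_snd)
    then have "continuous_map X E2 (fst \<circ> snd)" "continuous_map X E2 (snd \<circ> snd)"
      using continuous_map_compose continuous_map_fst continuous_map_snd by metis+
    then have "continuous_map X E (\<lambda>z. fst (snd z))" "continuous_map X E (\<lambda>z. snd (snd z))"
      using continuous_map_compose[OF _ E2E] by (simp_all add: o_def)
    moreover have "continuous_map X euclideanreal fst"
      unfolding X_def by (rule continuous_map_unit_intervalD[OF continuous_map_fst])
    ultimately show "continuous_map X E F"
      unfolding F_def by (intro tvs_continuous_map_segment[OF E])
    show "F \<in> topspace X \<rightarrow> V"
      using V2(2) by (auto simp: F_def X_def topE2 intro!: subsetD[OF V2(2)] conv2I)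
  qed
  define Q where "Q = {z \<in> topspace X. (\<psi> \<circ> F) z \<in> W}"
  have "openin X Q"
    unfolding Q_def using continuous_map_compose[OF F \<psi>M] W(1) by (rule openin_continuous_map_preimage)
  moreover have "{0..1} \<times> {(\<phi> q, \<phi> q)} \<subseteq> Q"
    using q W(2) inv[OF q(1)] by (auto simp: Q_def X_def F_def topE2 simp flip: scaleR_add_left)
  moreover have "compactin unit_interval {0..1}"
    by (simp add: compactin_subtopology)
  moreover have "(\<phi> q, \<phi> q) \<in> topspace (prod_topology E2 E2)"
    using q(2) by (simp add: topE2)
  ultimately obtain I0 V0 where V0: "openin (prod_topology E2 E2) V0" "{0..1} \<subseteq> I0"
      "(\<phi> q, \<phi> q) \<in> V0" "I0 \<times> V0 \<subseteq> Q"
    using tube_lemma_left[of unit_interval "prod_topology E2 E2" Q "{0..1}" "(\<phi> q, \<phi> q)"]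
    unfolding X_def by blast
  obtain G1 G2 where G12: "openin E2 G1" "openin E2 G2" "\<phi> q \<in> G1" "\<phi> q \<in> G2" "G1 \<times> G2 \<subseteq> V0"
    using V0(1)[unfolded openin_prod_topology_alt, rule_format, OF V0(3)] by blast
  \<comment> \<open>Both ends of a segment are to range over the same set, so that \<open>P\<close>
    can be contracted to one of its own points.\<close>
  define G where "G = G1 \<inter> G2"
  have "openin E2 G"
    unfolding G_def using G12(1,2) by (rule openin_Int)
  then have G: "openin (subtopology E V) G" "G \<subseteq> V2"
    using openin_trans_full[OF _ V2(1)] openin_subset topE2 unfolding E2_def by blast+
  have seg: "(1 - t) *\<^sub>R a + t *\<^sub>R b \<in> V \<and> \<psi> ((1 - t) *\<^sub>R a + t *\<^sub>R b) \<in> W"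
    if t: "t \<in> {0..1}" and ab: "a \<in> G" "b \<in> G" for t a b
  proof
    show "(1 - t) *\<^sub>R a + t *\<^sub>R b \<in> V"
      using t ab G(2) by (intro subsetD[OF V2(2)] conv2I) auto
    have "(t, a, b) \<in> Q"
      using t ab V0(2,4) G12(5) unfolding G_def by blast
    then show "\<psi> ((1 - t) *\<^sub>R a + t *\<^sub>R b) \<in> W"
      by (simp add: Q_def F_def)
  qed
  define P where "P = {x \<in> U. \<phi> x \<in> G}"
  have "openin (subtopology M U) {x \<in> topspace (subtopology M U). \<phi> x \<in> G}"
    using \<phi>_cont G(1) by (rule openin_continuous_map_preimage)
  then have P: "openin M P"
    using openin_trans_full[OF _ U] UM by (simp add: P_def Int_absorb1)
  have qP: "q \<in> P"
    using q(1) G12(3,4) by (simp add: P_def G_def)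
  have "q \<in> M closure_of (\<Union>\<alpha>\<in>A. topspace (Ms \<alpha>))"
    using dense \<open>q \<in> topspace M\<close> by simp
  \<comment> \<open>Density enters here: \<open>q\<close> itself need not lie in the union, but its
    open neighbourhood \<open>P\<close> meets it.\<close>
  then obtain y where y: "y \<in> topspace T" "y \<in> P"
    using P qP unfolding in_closure_of topT by blast
  define c where "c t p = \<psi> ((1 - t) *\<^sub>R \<phi> p + t *\<^sub>R \<phi> y)" for t p
  have cW: "c t p \<in> W" and cV: "(1 - t) *\<^sub>R \<phi> p + t *\<^sub>R \<phi> y \<in> V" if "t \<in> {0..1}" "p \<in> P" for t p
    using seg[OF that(1), of "\<phi> p" "\<phi> y"] that(2) y(2) by (simp_all add: c_def P_def)
  have c0: "c 0 p = p" and c1: "c 1 p = y" if "p \<in> P" for p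
    using that y(2) inv by (simp_all add: c_def P_def)
  have "P \<subseteq> W"
    using cW[of 0] c0 by fastforce
  moreover have "local_contraction T M P W c"
    unfolding local_contraction_def
  proof (intro conjI allI impI)
    show "continuous_map (prod_topology unit_interval (subtopology M P)) (subtopology M W) (\<lambda>(t, p). c t p)"
    proof (rule continuous_map_into_subtopology)
      let ?X = "prod_topology unit_interval (subtopology M P)"
      have "continuous_map ?X (subtopology M U) snd"
        using continuous_map_snd[of unit_interval "subtopology M P"]
        by (auto simp: continuous_map_in_subtopology P_def)
      from continuous_map_compose[OF this \<phi>_cont] have 1: "continuous_map ?X E (\<lambda>z. \<phi> (snd z))"
        by (simp add: continuous_map_in_subtopology o_def)
      have "\<phi> y \<in> topspace E"
        using y(2) G(2) V2V V by (auto simp: P_def)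
      then have "continuous_map ?X E (\<lambda>z. (1 - fst z) *\<^sub>R \<phi> (snd z) + fst z *\<^sub>R \<phi> y)"
        using 1 continuous_map_unit_intervalD[OF continuous_map_fst]
        by (intro tvs_continuous_map_segment[OF E]) simp_all
      then have "continuous_map ?X (subtopology E V) (\<lambda>z. (1 - fst z) *\<^sub>R \<phi> (snd z) + fst z *\<^sub>R \<phi> y)"
        using cV by (intro continuous_map_into_subtopology) auto
      from continuous_map_compose[OF this \<psi>M] show "continuous_map ?X M (\<lambda>(t, p). c t p)"
        by (rule continuous_map_eq) (auto simp: c_def)
      show "(\<lambda>(t, p). c t p) \<in> topspace ?X \<rightarrow> W"
        using cW by auto
    qed
    show "\<forall>p\<in>P. c 0 p = p"
      using c0 by simp
    show "\<exists>y\<in>topspace T. \<forall>p\<in>P. c 1 p = y"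
      using c1 y(1) by (intro bexI[of _ y]) simp_all
    fix K assume K: "compactin T K \<and> K \<subseteq> P"
    have "K \<subseteq> {x \<in> U. \<phi> x \<in> V2}" "y \<in> U" "\<phi> y \<in> V2"
      using K y(2) G(2) by (auto simp: P_def)
    from chart_segment_continuous[OF dir MM MT retr chart inv conjunct1[OF K] this(1) y(1) this(2,3)]
    show "continuous_map (prod_topology unit_interval (subtopology T K)) T (\<lambda>(t, p). c t p)"
      unfolding c_def .
  qed
  ultimately show "\<exists>P c. openin M P \<and> q \<in> P \<and> P \<subseteq> W \<and> local_contraction T M P W c"
    using P qP by blast
qed

theorem proposition6p1:
  fixes M :: "'a topology"
    and A :: "'i set" and le :: "'i \<Rightarrow> 'i \<Rightarrow> bool"
    and Ms :: "'i \<Rightarrow> 'a topology"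
    and T :: "'a topology"
  assumes "Hausdorff_space M"
    and "\<And>\<alpha>. \<alpha> \<in> A \<Longrightarrow> Hausdorff_space (Ms \<alpha>)"
    and "directed_family A le (\<lambda>\<alpha>. topspace (Ms \<alpha>))"
    and "(\<Union>\<alpha>\<in>A. topspace (Ms \<alpha>)) \<subseteq> topspace M"
    and "M closure_of (\<Union>\<alpha>\<in>A. topspace (Ms \<alpha>)) = topspace M"
    and "\<And>\<alpha>. \<alpha> \<in> A \<Longrightarrow> continuous_map (Ms \<alpha>) M id"
    and "\<And>\<alpha> \<beta>. \<alpha> \<in> A \<Longrightarrow> \<beta> \<in> A \<Longrightarrow> le \<alpha> \<beta> \<Longrightarrow> continuous_map (Ms \<alpha>) (Ms \<beta>) id"
    and "admits_well_filled_charts TYPE('e::real_vector) A le M Ms"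
    and "Hausdorff_space T"
    and "topspace T = (\<Union>\<alpha>\<in>A. topspace (Ms \<alpha>))"
    and "\<And>\<alpha>. \<alpha> \<in> A \<Longrightarrow> continuous_map (Ms \<alpha>) T id"
    and "continuous_map T M id"
    and "compactly_retractive T A Ms"
  shows "weak_homotopy_equivalence T M id"
proof (rule locally_contracting_imp_weak_homotopy_equivalence)
  show "continuous_map T M id"
    by fact
  show "locally_contracting T M"
    using assms(3,5,7,8,10,11,13) by (rule well_filled_charts_imp_locally_contracting)
qed

end
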